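(* Let $\mathbb F$ be an algebraically closed field of characteristic zero, $\mathbf n=(n_1,\dots,n_k)$, $\mathbf d=(d_1,\dots,d_k)$ tuples of positive integers, $d=d_1+\cdots+d_k$. For every nonzero linear map $\phi:V(\mathbf n,\mathbf d)\to M_{p,q}$ (matrix-rank method with simples $S(\mathbf n,\mathbf d)$), $$\mathrm{Pot}(\phi)\le Y_{\mathbf n,\mathbf d}+Z_{\mathbf n,\mathbf d},$$ where, with variables $\mathbf z=(\mathbf z_1,\dots,\mathbf z_k)$, $\mathbf z_i=(z_{i1},\dots,z_{in_i})$, $Y_{\mathbf n,\mathbf d}$ is the number of monomials in $\mathbf z$ with set multi-degree $\preceq\mathbf d$ and total degree $\le\lfloor d/2\rfloor$, and $Z_{\mathbf n,\mathbf d}$ is the number of monomials in $\mathbf z$ with set multi-degree $\preceq\mathbf d$ and total degree $\le d-(\lfloor d/2\rfloor+1)$.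
   Context: $P(N,e)$: homogeneous degree-$e$ polynomials in $N$ variables. $V(\mathbf n,\mathbf d)=P(n_1+1,d_1)\otimes\cdots\otimes P(n_k+1,d_k)$ and $S(\mathbf n,\mathbf d)=\{\ell_1^{d_1}\otimes\cdots\otimes\ell_k^{d_k}:\ell_i\in P(n_i+1,1)\}$. The set multi-degree of the monomial $\prod_{i,j}z_{ij}^{e_{ij}}$ is $(\sum_je_{1j},\dots,\sum_je_{kj})\in\mathbb N^k$; $\preceq$ is the componentwise order on $\mathbb N^k$. For linear $\phi:V\to M_{p,q}$ and spanning $S$, $\mu_\phi(v)=\mathrm{rank}(\phi(v))$, $\mu_\phi(X)=\max_{x\in X}\mu_\phi(x)$, $\mathrm{Pot}(\phi)=\mu_\phi(V)/\mu_\phi(S)$. *)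

theory Defs
  imports "Jordan_Normal_Form.DL_Rank"
begin

class alg_closed_field = field +
  assumes alg_closed: "0 < m \<Longrightarrow> \<exists>x. x ^ m + (\<Sum>i<m. c i * x ^ i) = 0"

text \<open>Multi-indices are functions e :: nat \<Rightarrow> nat \<Rightarrow> nat, e i j = exponent of variable x_{ij}.
  Basis of V(n,d) = P(n_1+1,d_1) \<otimes> ... \<otimes> P(n_k+1,d_k): tensor products of monomials,
  i.e. multi-indices e with e i j = 0 unless i < k and j \<le> n_i, and \<Sum>_{j\<le>n_i} e i j = d_i.\<close>
definition Vbasis :: "nat list \<Rightarrow> nat list \<Rightarrow> (nat \<Rightarrow> nat \<Rightarrow> nat) set" where
  "Vbasis n d = {e. (\<forall>i j. (i \<ge> length n \<or> j > n ! i) \<longrightarrow> e i j = 0) \<and>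
                    (\<forall>i < length n. (\<Sum>j\<le>n ! i. e i j) = d ! i)}"

text \<open>V(n,d) in coordinates w.r.t. this basis.\<close>
definition Vspace :: "nat list \<Rightarrow> nat list \<Rightarrow> ((nat \<Rightarrow> nat \<Rightarrow> nat) \<Rightarrow> 'a::field) set" where
  "Vspace n d = {v. \<forall>e. e \<notin> Vbasis n d \<longrightarrow> v e = 0}"

text \<open>Coordinates of \<ell>_1^{d_1} \<otimes> ... \<otimes> \<ell>_k^{d_k}, where \<ell>_i = \<Sum>_{j\<le>n_i} c i j x_{ij}
  (multinomial expansion).\<close>
definition simple_tensor :: "nat list \<Rightarrow> nat list \<Rightarrow> (nat \<Rightarrow> nat \<Rightarrow> 'a::field)
    \<Rightarrow> (nat \<Rightarrow> nat \<Rightarrow> nat) \<Rightarrow> 'a" where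
  "simple_tensor n d c e = (if e \<in> Vbasis n d then
     (\<Prod>i<length n. of_nat (fact (d ! i) div (\<Prod>j\<le>n ! i. fact (e i j)))
                    * (\<Prod>j\<le>n ! i. c i j ^ e i j))
   else 0)"

definition Sset :: "nat list \<Rightarrow> nat list \<Rightarrow> ((nat \<Rightarrow> nat \<Rightarrow> nat) \<Rightarrow> 'a::field) set" where
  "Sset n d = {simple_tensor n d c | c. True}"

definition lin_to_mat :: "nat list \<Rightarrow> nat list \<Rightarrow> nat \<Rightarrow> nat
    \<Rightarrow> (((nat \<Rightarrow> nat \<Rightarrow> nat) \<Rightarrow> 'a::field) \<Rightarrow> 'a mat) \<Rightarrow> bool" where
  "lin_to_mat n d p q \<phi> \<longleftrightarrow>
     (\<forall>v \<in> Vspace n d. \<phi> v \<in> carrier_mat p q) \<and>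
     (\<forall>u \<in> Vspace n d. \<forall>v \<in> Vspace n d. \<phi> (\<lambda>e. u e + v e) = \<phi> u + \<phi> v) \<and>
     (\<forall>a. \<forall>v \<in> Vspace n d. \<phi> (\<lambda>e. a * v e) = a \<cdot>\<^sub>m \<phi> v)"

definition mu :: "nat \<Rightarrow> ('v \<Rightarrow> 'a::field mat) \<Rightarrow> 'v set \<Rightarrow> nat" where
  "mu p \<phi> X = Max ((\<lambda>x. vec_space.rank p (\<phi> x)) ` X)"

definition Pot :: "nat list \<Rightarrow> nat list \<Rightarrow> nat \<Rightarrow> (((nat \<Rightarrow> nat \<Rightarrow> nat) \<Rightarrow> 'a::field) \<Rightarrow> 'a mat) \<Rightarrow> real" where
  "Pot n d p \<phi> = real (mu p \<phi> (Vspace n d)) / real (mu p \<phi> (Sset n d))"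

definition monoms :: "nat list \<Rightarrow> nat list \<Rightarrow> int \<Rightarrow> (nat \<Rightarrow> nat \<Rightarrow> nat) set" where
  "monoms n d t = {e. (\<forall>i j. (i \<ge> length n \<or> j < 1 \<or> j > n ! i) \<longrightarrow> e i j = 0) \<and>
                     (\<forall>i < length n. (\<Sum>j\<in>{1..n ! i}. e i j) \<le> d ! i) \<and>
                     int (\<Sum>i<length n. \<Sum>j\<in>{1..n ! i}. e i j) \<le> t}"

definition Ycount :: "nat list \<Rightarrow> nat list \<Rightarrow> nat" where
  "Ycount n d = card (monoms n d (int (sum_list d div 2)))"

definition Zcount :: "nat list \<Rightarrow> nat list \<Rightarrow> nat" where
  "Zcount n d = card (monoms n d (int (sum_list d) - (int (sum_list d div 2) + 1)))"

end

(*
  The entries of phi on simple tensors, with the coefficient of x_{i0} normalised to 1, form a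
  matrix A of polynomials in the affine variables z. Let s be the largest size of an identity
  matrix of the form C * A(z) * D over all points z; s is at most mu(S), and after a translation it
  is attained at z = 0. With M = C * A * D and f = det M, maximality of s gives
  f A = A D adj(M) C A, and f is invertible as a power series because f(0) = 1. Hence, up to the
  degree that matters, A = L * R as matrices of polynomials with inner dimension s, that is,
  A_e = sum over a + b = e of L_a R_b. As |e| <= d, either |a| <= d div 2 or
  |b| <= d - (d div 2 + 1), so that any linear combination of the A_e is a sum of at most
  Y products L_a * (...) and at most Z products (...) * R_b, each of rank at most s. In
  characteristic zero every phi(v) is such a combination.
*)
theory Submission
  imports Defs "HOL-Library.Poly_Mapping" "HOL-Library.Multiset"
begin

section \<open>Rank and compressions to the identity\<close>

text \<open>Each index \<open>x\<close> contributes an outer product, of rank at most 1, and rank is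
  subadditive.\<close>

lemma rank_le_card_summands:
  fixes A :: "'a::field mat"
  assumes "finite I" and "A \<in> carrier_mat p q"
    and "\<And>i j. i < p \<Longrightarrow> j < q \<Longrightarrow> A $$ (i, j) = (\<Sum>x\<in>I. u x i * w x j)"
  shows "vec_space.rank p A \<le> card I"
  using assms
proof (induction I arbitrary: A rule: finite_induct)
  case empty
  then have "A = 0\<^sub>m p q" by (intro eq_matI) auto
  then show ?case by (simp add: vec_space.rank_0I)
next
  case (insert x I)
  define B where "B = mat p q (\<lambda>(i, j). \<Sum>x\<in>I. u x i * w x j)"
  define B' where "B' = mat p q (\<lambda>(i, j). u x i * w x j)"
  have "A = B' + B"
    using insert by (intro eq_matI) (auto simp: B_def B'_def)
  moreover have "vec_space.rank p B \<le> card I"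
    by (rule insert.IH) (auto simp: B_def)
  moreover have "vec_space.rank p B' \<le> 1"
    by (rule vec_space.rank_le_1_product_entries[where nc = q and f = "u x" and g = "w x"]) (auto simp: B'_def)
  moreover have "vec_space.rank p (B' + B) \<le> vec_space.rank p B' + vec_space.rank p B"
    by (rule vec_space.rank_subadditive[where nc = q]) (auto simp: B_def B'_def)
  ultimately show ?case using insert by simp
qed

text \<open>Over a field this amounts to rank at least \<open>s\<close>. The explicit
  \<open>C\<close> and \<open>D\<close> matter: found at one point, they are kept constant while the
  entries of a polynomial matrix vary.\<close>

definition compresses_to_one :: "'a::field mat \<Rightarrow> nat \<Rightarrow> bool" where
  "compresses_to_one A s \<longleftrightarrow> (\<exists>C D. C \<in> carrier_mat s (dim_row A) \<and> D \<in> carrier_mat (dim_col A) s \<and> C * A * D = 1\<^sub>m s)"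

text \<open>\<open>B = A * D\<close> has the left inverse \<open>C\<close>, so its \<open>s\<close>
  columns are distinct and linearly independent, and they lie in the column space of
  \<open>A\<close>.\<close>

lemma compresses_to_one_le_rank:
  fixes A :: "'a::field mat"
  assumes A: "A \<in> carrier_mat p q" and "compresses_to_one A s"
  shows "s \<le> vec_space.rank p A"
proof -
  interpret vec_space "TYPE('a)" p .
  obtain C D where C: "C \<in> carrier_mat s p" and D: "D \<in> carrier_mat q s" and CAD: "C * A * D = 1\<^sub>m s"
    using assms unfolding compresses_to_one_def by auto
  define B where "B = A * D"
  have B: "B \<in> carrier_mat p s" using A D by (auto simp: B_def)
  have CB: "C * B = 1\<^sub>m s" using CAD A C D by (simp add: B_def)
  have colB: "C *\<^sub>v col B j = unit_vec s j" if "j < s" for j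
  proof -
    have "C *\<^sub>v col B j = col (C * B) j" by (rule col_mult2[OF C B that, symmetric])
    then show ?thesis using that by (simp add: CB)
  qed
  have dist: "distinct (cols B)"
  proof (subst distinct_conv_nth, intro allI impI)
    fix i j assume ij: "i < length (cols B)" "j < length (cols B)" "i \<noteq> j"
    then have "i < s" "j < s" using B by auto
    then have "col B i \<noteq> col B j"
      using colB[of i] colB[of j] ij(3) by (metis index_unit_vec(1) one_neq_zero)
    then show "cols B ! i \<noteq> cols B ! j" using ij by simp
  qed
  have indpt: "lin_indpt (set (cols B))"
  proof
    assume "lin_dep (set (cols B))"
    then obtain v where v: "v \<in> carrier_vec s" "v \<noteq> 0\<^sub>v s" "B *\<^sub>v v = 0\<^sub>v p"
      by (rule lin_depE[OF B _ dist])
    have "v = (C * B) *\<^sub>v v" using v by (simp add: CB)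
    also have "\<dots> = C *\<^sub>v 0\<^sub>v p" using v by (simp add: assoc_mult_mat_vec[OF C B])
    also have "\<dots> = 0\<^sub>v s" using C by (intro eq_vecI) auto
    finally show False using v by simp
  qed
  have sub: "set (cols B) \<subseteq> col_space A"
  proof
    fix x assume "x \<in> set (cols B)"
    then obtain j where j: "j < s" "x = col B j" using B by (auto simp: cols_def)
    then have "x = A *\<^sub>v col D j" using col_mult2[OF A D j(1)] by (simp only: B_def)
    then show "x \<in> col_space A" using A D j by (auto simp: col_space_eq[OF A])
  qed
  have colsA: "set (cols A) \<subseteq> carrier_vec p" using A cols_dim by blast
  have card: "card (set (cols B)) = s" using dist B by (simp add: distinct_card)
  have vs: "vectorspace class_ring (span_vs (set (cols A)))"
    using colsA by (simp add: span_is_subspace subspace_is_vs)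
  have indpt': "LinearCombinations.module.lin_indpt class_ring (span_vs (set (cols A))) (set (cols B))"
    using span_li_not_depend(2)[of "set (cols B)" "span (set (cols A))"] sub indpt colsA
    by (simp add: col_space_def span_is_submodule)
  show ?thesis
    using vectorspace.li_le_dim(2)[OF vs fin_dim_span_cols[OF A] _ indpt'] sub card
    by (simp add: rank_def col_space_def)
qed

lemma index_mult_mult_mat:
  fixes A :: "'a::comm_semiring_1 mat"
  assumes "X \<in> carrier_mat m p" "A \<in> carrier_mat p q" "Y \<in> carrier_mat q n" "i < m" "j < n"
  shows "(X * A * Y) $$ (i, j) = row X i \<bullet> (A *\<^sub>v col Y j)"
proof -
  have "X * A * Y = X * (A * Y)" using assms by simp
  moreover have "col (A * Y) j = A *\<^sub>v col Y j" by (rule col_mult2[OF assms(2,3,5)])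
  ultimately show ?thesis using assms by (simp del: col_mult2)
qed

text \<open>With \<open>P = 1 - A * D * C\<close> and \<open>Q = 1 - D * C * A\<close> one gets
  \<open>C * A * Q = 0\<close>, \<open>P * A * D = 0\<close> and
  \<open>P * A * Q = A - A * D * C * A\<close>. Thus \<open>A\<close> splits into an identity block
  and the block \<open>P * A * Q\<close>, and a nonzero entry of the latter would produce an
  identity of size \<open>Suc s\<close>.\<close>

lemma maximal_compression:
  fixes A :: "'a::field mat"
  assumes A: "A \<in> carrier_mat p q" and C: "C \<in> carrier_mat s p" and D: "D \<in> carrier_mat q s"
    and CAD: "C * A * D = 1\<^sub>m s" and max: "\<not> compresses_to_one A (Suc s)"
  shows "A = A * D * C * A"
proof (rule ccontr)
  assume ne: "A \<noteq> A * D * C * A"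
  define P where "P = 1\<^sub>m p - A * D * C"
  define Q where "Q = 1\<^sub>m q - D * C * A"
  have P: "P \<in> carrier_mat p p" and Q: "Q \<in> carrier_mat q q" using A C D by (auto simp: P_def Q_def)
  have DCA: "D * C * A \<in> carrier_mat q q" and ADC: "A * D * C \<in> carrier_mat p p" using A C D by auto
  have CAQ: "C * A * Q = 0\<^sub>m s q"
  proof -
    have "C * A * (D * C * A) = (C * A * D) * (C * A)"
      using assoc_mult_mat[of "C * A" s q D s "C * A" q] A C D by simp
    moreover have "C * A * Q = C * A - C * A * (D * C * A)"
      using mult_minus_distrib_mat[of "C * A" s q "1\<^sub>m q" q "D * C * A"] A C DCA by (simp add: Q_def)
    moreover have "1\<^sub>m s * (C * A) = C * A" using A C by simp
    ultimately show ?thesis using A C by (simp add: CAD minus_r_inv_mat del: assoc_mult_mat)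
  qed
  have PAD: "P * A * D = 0\<^sub>m p s"
  proof -
    have "A * D * C * A * D = (A * D) * (C * A * D)"
      using assoc_mult_mat[of "A * D" p s C p A q] assoc_mult_mat[of "A * D" p s "C * A" q D s] A C D
      by (simp del: assoc_mult_mat)
    moreover have "P * A * D = A * D - A * D * C * A * D"
    proof -
      have "P * A = A - A * D * C * A"
        using minus_mult_distrib_mat[of "1\<^sub>m p" p p "A * D * C" A q] A ADC by (simp add: P_def del: assoc_mult_mat)
      then show ?thesis
        using minus_mult_distrib_mat[of A p q "A * D * C * A" D s] mult_carrier_mat[OF ADC A] A D
        by (simp del: assoc_mult_mat)
    qed
    moreover have "A * D * 1\<^sub>m s = A * D" using A D by simp
    ultimately show ?thesis using A D by (simp add: CAD minus_r_inv_mat del: assoc_mult_mat)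
  qed
  have PAQ: "P * A * Q = A - A * D * C * A"
  proof -
    have ADCA: "A * D * C * A \<in> carrier_mat p q" using A C D by auto
    have "P * A = A - A * D * C * A"
      using minus_mult_distrib_mat[of "1\<^sub>m p" p p "A * D * C" A q] A ADC by (simp add: P_def del: assoc_mult_mat)
    then have "P * A * Q = A * Q - A * D * C * A * Q"
      using minus_mult_distrib_mat[OF A ADCA Q] by (simp del: assoc_mult_mat)
    moreover have "A * D * C * A * Q = A * D * (C * A * Q)"
      using assoc_mult_mat[of "A * D" p s C p A q] assoc_mult_mat[of "A * D" p s "C * A" q Q q] A C D Q
      by (simp del: assoc_mult_mat)
    moreover have "A * D * 0\<^sub>m s q = 0\<^sub>m p q" using A D by simp
    moreover have "A * Q = A - A * (D * C * A)"
      using mult_minus_distrib_mat[of A p q "1\<^sub>m q" q "D * C * A"] A DCA by (simp add: Q_def del: assoc_mult_mat)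
    moreover have "A * (D * C * A) = A * D * C * A"
      using assoc_mult_mat[of A p q "D * C" p A q] A C D by simp
    ultimately show ?thesis using ADCA A by (intro eq_matI) (auto simp: CAQ simp del: assoc_mult_mat)
  qed
  obtain i j where ij: "i < p" "j < q" "(P * A * Q) $$ (i, j) \<noteq> 0"
  proof -
    have "\<not> (\<forall>i<p. \<forall>j<q. A $$ (i, j) = (A * D * C * A) $$ (i, j))"
      using ne A C D by (auto intro!: eq_matI)
    then show thesis using that A C D PAQ by auto
  qed
  text \<open>A nonzero entry of \<open>P * A * Q\<close> enlarges the compression by one row of \<open>P\<close> and one column of \<open>Q\<close>.\<close>
  define a where "a = (P * A * Q) $$ (i, j)"
  define C' where "C' = mat (Suc s) p (\<lambda>(k, l). if k < s then C $$ (k, l) else inverse a * P $$ (i, l))"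
  define D' where "D' = mat q (Suc s) (\<lambda>(k, l). if l < s then D $$ (k, l) else Q $$ (k, j))"
  have C': "C' \<in> carrier_mat (Suc s) p" and D': "D' \<in> carrier_mat q (Suc s)" by (auto simp: C'_def D'_def)
  have rows: "row C' k = (if k < s then row C k else inverse a \<cdot>\<^sub>v row P i)" if "k < Suc s" for k
    using that C P ij by (intro eq_vecI) (auto simp: C'_def)
  have cols: "col D' k = (if k < s then col D k else col Q j)" if "k < Suc s" for k
    using that D Q ij by (intro eq_vecI) (auto simp: D'_def)
  have car: "A *\<^sub>v col Q j \<in> carrier_vec p" "\<And>l. l < s \<Longrightarrow> A *\<^sub>v col D l \<in> carrier_vec p" "row P i \<in> carrier_vec p"
    using A Q D P ij by auto
  have "C' * A * D' = 1\<^sub>m (Suc s)"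
  proof (rule eq_matI)
    fix k l assume "k < dim_row (1\<^sub>m (Suc s) :: 'a mat)" "l < dim_col (1\<^sub>m (Suc s) :: 'a mat)"
    then have kl: "k < Suc s" "l < Suc s" by auto
    have e: "(C' * A * D') $$ (k, l) = row C' k \<bullet> (A *\<^sub>v col D' l)"
      by (rule index_mult_mult_mat[OF C' A D' kl])
    \<comment> \<open>The four blocks of the enlarged product: the old identity, two vanishing
      off-diagonal parts, and the corner entry \<open>a\<close>, which \<open>inverse a\<close> in
      the last row of \<open>C'\<close> scales to 1.\<close>
    have "row C k \<bullet> (A *\<^sub>v col D l) = (if k = l then 1 else 0)" if "k < s" "l < s"
      using index_mult_mult_mat[OF C A D that] that by (simp add: CAD)
    moreover have "row C k \<bullet> (A *\<^sub>v col Q j) = 0" if "k < s"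
      using index_mult_mult_mat[OF C A Q that ij(2)] that ij by (simp add: CAQ)
    moreover have "row P i \<bullet> (A *\<^sub>v col D l) = 0" if "l < s"
      using index_mult_mult_mat[OF P A D ij(1) that] that ij by (simp add: PAD)
    moreover have "row P i \<bullet> (A *\<^sub>v col Q j) = a"
      using index_mult_mult_mat[OF P A Q ij(1,2)] by (simp add: a_def)
    moreover have "a \<noteq> 0" using ij by (simp add: a_def)
    ultimately show "(C' * A * D') $$ (k, l) = 1\<^sub>m (Suc s) $$ (k, l)"
      using kl car by (auto simp: e rows cols)
  qed (use C' D' in auto)
  then have "compresses_to_one A (Suc s)"
    unfolding compresses_to_one_def using A C' D' by (intro exI[of _ C'] exI[of _ D']) (simp del: assoc_mult_mat)
  with max show False by simp
qed

text \<open>Multiplying \<open>D\<close> on the right by the inverse of \<open>M = C * A * D\<close>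
  turns the compression into the identity, so \<open>maximal_compression\<close> applies. With the
  inverse written as \<open>adj_mat M\<close> over \<open>det M\<close>, clearing the denominator
  leaves an identity that is polynomial in the entries of \<open>A\<close>.\<close>

lemma adj_mat_compression:
  fixes A :: "'a::field mat"
  assumes A: "A \<in> carrier_mat p q" and C: "C \<in> carrier_mat s p" and D: "D \<in> carrier_mat q s"
    and max: "\<not> compresses_to_one A (Suc s)" and nz: "det (C * A * D) \<noteq> 0"
  shows "det (C * A * D) \<cdot>\<^sub>m A = A * D * adj_mat (C * A * D) * C * A"
proof -
  define M where "M = C * A * D"
  have M: "M \<in> carrier_mat s s" using A C D by (auto simp: M_def)
  define D' where "D' = D * (inverse (det M) \<cdot>\<^sub>m adj_mat M)"
  have D': "D' \<in> carrier_mat q s" using D adj_mat(1)[OF M] by (auto simp: D'_def)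
  have "C * A * D' = M * (inverse (det M) \<cdot>\<^sub>m adj_mat M)"
    using assoc_mult_mat[of "C * A" s q D s "inverse (det M) \<cdot>\<^sub>m adj_mat M" s] A C D adj_mat(1)[OF M]
    by (simp add: M_def D'_def)
  also have "\<dots> = inverse (det M) \<cdot>\<^sub>m (det M \<cdot>\<^sub>m 1\<^sub>m s)"
    using M adj_mat(1)[OF M] by (simp add: mult_smult_distrib adj_mat(2)[OF M])
  also have "\<dots> = 1\<^sub>m s" using nz by (intro eq_matI) (auto simp: M_def)
  finally have "A = A * D' * C * A" by (intro maximal_compression[OF A C D'] max)
  also have "A * D' * C * A = inverse (det M) \<cdot>\<^sub>m (A * D * adj_mat M * C * A)"
  proof -
    have "A * D' = inverse (det M) \<cdot>\<^sub>m (A * D * adj_mat M)"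
      using A D adj_mat(1)[OF M] mult_smult_distrib[of "A * D" p s "adj_mat M" s "inverse (det M)"]
        assoc_mult_mat[of A p q D s "inverse (det M) \<cdot>\<^sub>m adj_mat M" s]
      by (simp add: D'_def)
    moreover have "(c \<cdot>\<^sub>m (A * D * adj_mat M)) * C = c \<cdot>\<^sub>m (A * D * adj_mat M * C)" for c
      by (rule mult_smult_assoc_mat) (use A C D adj_mat(1)[OF M] in auto)
    moreover have "(c \<cdot>\<^sub>m (A * D * adj_mat M * C)) * A = c \<cdot>\<^sub>m (A * D * adj_mat M * C * A)" for c
      by (rule mult_smult_assoc_mat) (use A C D adj_mat(1)[OF M] in auto)
    ultimately show ?thesis by simp
  qed
  finally have "det M \<cdot>\<^sub>m A = det M \<cdot>\<^sub>m (inverse (det M) \<cdot>\<^sub>m (A * D * adj_mat M * C * A))" by simp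
  also have "\<dots> = A * D * adj_mat M * C * A"
    using nz A C D by (intro eq_matI) (auto simp: M_def)
  finally show ?thesis by (simp add: M_def)
qed

section \<open>Polynomials as finitely supported functions on multisets\<close>

text \<open>A monomial is the multiset of its variables: multiset sum is multiplication,
  submultisets are divisors, and \<open>size\<close> is the total degree.\<close>

type_synonym ('x, 'a) mpoly = "'x multiset \<Rightarrow>\<^sub>0 'a"

text \<open>The coefficient map \<open>h\<close> is a parameter so that the same definition gives
  evaluation at a point (\<open>h = id\<close>) and substitution of polynomials for variables
  (\<open>h = const_mpoly\<close>).\<close>

definition insertion :: "('a::comm_ring_1 \<Rightarrow> 'b::comm_ring_1) \<Rightarrow> ('x \<Rightarrow> 'b) \<Rightarrow> ('x, 'a) mpoly \<Rightarrow> 'b" where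
  "insertion h g p = (\<Sum>e\<in>Poly_Mapping.keys p. h (Poly_Mapping.lookup p e) * \<Prod>\<^sub># (image_mset g e))"

lemma insertion_superset:
  assumes "h 0 = 0" "finite E" "Poly_Mapping.keys p \<subseteq> E"
  shows "insertion h g p = (\<Sum>e\<in>E. h (Poly_Mapping.lookup p e) * \<Prod>\<^sub># (image_mset g e))"
  unfolding insertion_def using assms
  by (intro sum.mono_neutral_left) (auto simp: in_keys_iff)

lemma poly_mapping_sum_single:
  "p = (\<Sum>e\<in>Poly_Mapping.keys p. Poly_Mapping.single e (Poly_Mapping.lookup p e))"
  by (rule poly_mapping_eqI) (simp add: lookup_sum lookup_single when_def in_keys_iff)

lemma insertion_single:
  assumes "h 0 = 0"
  shows "insertion h g (Poly_Mapping.single e c) = h c * \<Prod>\<^sub># (image_mset g e)"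
  using assms insertion_superset[of h "{e}" "Poly_Mapping.single e c" g] by simp

context comm_ring_hom
begin

lemma insertion_add: "insertion hom g (p + q) = insertion hom g p + insertion hom g q"
proof -
  let ?E = "Poly_Mapping.keys p \<union> Poly_Mapping.keys q"
  have *: "insertion hom g r = (\<Sum>e\<in>?E. hom (Poly_Mapping.lookup r e) * \<Prod>\<^sub># (image_mset g e))"
    if "Poly_Mapping.keys r \<subseteq> ?E" for r
    by (rule insertion_superset) (use that in auto)
  show ?thesis
    using Poly_Mapping.keys_add[of p q]
    by (simp add: * lookup_add hom_add sum.distrib distrib_right)
qed

lemma insertion_0: "insertion hom g 0 = 0"
  by (simp add: insertion_def)

lemma insertion_sum: "insertion hom g (sum f A) = (\<Sum>x\<in>A. insertion hom g (f x))"
  by (induction A rule: infinite_finite_induct) (auto simp: insertion_0 insertion_add)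

lemma insertion_mult: "insertion hom g (p * q) = insertion hom g p * insertion hom g q"
proof -
  let ?s = "\<lambda>p e. Poly_Mapping.single e (Poly_Mapping.lookup p e)"
  have "p * q = (\<Sum>a\<in>Poly_Mapping.keys p. \<Sum>b\<in>Poly_Mapping.keys q. ?s p a * ?s q b)"
    unfolding sum_product[symmetric] poly_mapping_sum_single[symmetric] ..
  then have "insertion hom g (p * q) = (\<Sum>a\<in>Poly_Mapping.keys p. \<Sum>b\<in>Poly_Mapping.keys q. insertion hom g (?s p a * ?s q b))"
    by (simp add: insertion_sum)
  also have "\<dots> = (\<Sum>a\<in>Poly_Mapping.keys p. \<Sum>b\<in>Poly_Mapping.keys q. insertion hom g (?s p a) * insertion hom g (?s q b))"
    by (simp add: mult_single insertion_single hom_mult mult_ac)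
  also have "\<dots> = insertion hom g p * insertion hom g q"
    unfolding sum_product[symmetric] insertion_sum[symmetric] poly_mapping_sum_single[symmetric] ..
  finally show ?thesis .
qed

lemma comm_ring_hom_insertion: "comm_ring_hom (insertion hom g)"
  by unfold_locales
    (auto simp: insertion_0 insertion_add insertion_mult insertion_single
      simp flip: single_one)

end

lemma comm_ring_hom_single: "comm_ring_hom (\<lambda>c::'a::comm_ring_1. Poly_Mapping.single ({#}::'x multiset) c)"
  by unfold_locales (auto simp: single_add mult_single)

abbreviation eval_mpoly :: "('x \<Rightarrow> 'a::comm_ring_1) \<Rightarrow> ('x, 'a) mpoly \<Rightarrow> 'a" where
  "eval_mpoly \<equiv> insertion id"

lemma comm_ring_hom_id: "comm_ring_hom id" by unfold_locales auto

lemma comm_ring_hom_eval_mpoly: "comm_ring_hom (eval_mpoly z)"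
  by (rule comm_ring_hom.comm_ring_hom_insertion[OF comm_ring_hom_id])

section \<open>Coefficients of products and the order of vanishing at the origin\<close>

lemma finite_subset_mset: "finite {A. A \<subseteq># M}"
proof (induction M)
  case (add x M)
  have "{A. A \<subseteq># add_mset x M} \<subseteq> {A. A \<subseteq># M} \<union> add_mset x ` {A. A \<subseteq># M}"
  proof
    fix A assume "A \<in> {A. A \<subseteq># add_mset x M}"
    then have A: "A \<subseteq># add_mset x M" by simp
    show "A \<in> {A. A \<subseteq># M} \<union> add_mset x ` {A. A \<subseteq># M}"
    proof (cases "x \<in># A")
      case True
      then obtain B where "A = add_mset x B" by (auto dest: multi_member_split)
      then show ?thesis using A by auto
    next
      case False
      have "A \<subseteq># M"
      proof (rule mset_subset_eqI)
        fix a show "count A a \<le> count M a"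
          using mset_subset_eq_count[OF A, of a] False by (cases "a = x") (auto simp: not_in_iff)
      qed
      then show ?thesis by simp
    qed
  qed
  then show ?case by (rule finite_subset) (use add in simp)
qed auto

text \<open>The Cauchy product: \<open>e = a + b\<close> holds exactly when \<open>a\<close> is a
  submultiset of \<open>e\<close> and \<open>b = e - a\<close>.\<close>

lemma lookup_mult_mset:
  fixes p q :: "('x, 'a::comm_ring_1) mpoly"
  shows "Poly_Mapping.lookup (p * q) e = (\<Sum>a | a \<subseteq># e. Poly_Mapping.lookup p a * Poly_Mapping.lookup q (e - a))"
proof -
  let ?s = "\<lambda>p e. Poly_Mapping.single e (Poly_Mapping.lookup p e)"
  have inner: "(\<Sum>b. Poly_Mapping.lookup q b when e = a + b) = (if a \<subseteq># e then Poly_Mapping.lookup q (e - a) else 0)" for a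
  proof (cases "a \<subseteq># e")
    case True
    then have "e = a + b \<longleftrightarrow> b = e - a" for b by (auto simp: subset_mset.add_diff_inverse)
    then show ?thesis using True by simp
  next
    case False
    then have "e \<noteq> a + b" for b by auto
    then show ?thesis using False by simp
  qed
  have "Poly_Mapping.lookup (p * q) e = (\<Sum>a. Poly_Mapping.lookup p a * (if a \<subseteq># e then Poly_Mapping.lookup q (e - a) else 0))"
    unfolding lookup_mult inner ..
  also have "\<dots> = (\<Sum>a | a \<subseteq># e. Poly_Mapping.lookup p a * (if a \<subseteq># e then Poly_Mapping.lookup q (e - a) else 0))"
    by (rule Sum_any.expand_superset) (auto simp: finite_subset_mset split: if_splits)
  finally show ?thesis by simp
qed

text \<open>Membership in the \<open>m\<close>-th power of the ideal generated by the variables; it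
  expresses congruence up to degree \<open>m - 1\<close> without passing to power series.\<close>

definition low_vanishing :: "nat \<Rightarrow> ('x, 'a::comm_ring_1) mpoly \<Rightarrow> bool" where
  "low_vanishing m p \<longleftrightarrow> (\<forall>e. size e < m \<longrightarrow> Poly_Mapping.lookup p e = 0)"

lemma low_vanishing_mult:
  assumes "low_vanishing m p" "low_vanishing k q"
  shows "low_vanishing (m + k) (p * q)"
  unfolding low_vanishing_def
proof (intro allI impI)
  fix e :: "'a multiset" assume e: "size e < m + k"
  have "Poly_Mapping.lookup p a * Poly_Mapping.lookup q (e - a) = 0" if "a \<subseteq># e" for a
  proof -
    have "size a + size (e - a) = size e" using that by (metis size_union subset_mset.add_diff_inverse)
    then have "size a < m \<or> size (e - a) < k" using e by linarith
    then show ?thesis using assms unfolding low_vanishing_def by auto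
  qed
  then show "Poly_Mapping.lookup (p * q) e = 0" by (simp add: lookup_mult_mset)
qed

lemma low_vanishing_mult_left: "low_vanishing m p \<Longrightarrow> low_vanishing m (p * q)"
  using low_vanishing_mult[of m p 0 q] by (simp add: low_vanishing_def)

lemma low_vanishing_power: "low_vanishing 1 p \<Longrightarrow> low_vanishing m (p ^ m)"
proof (induction m)
  case 0 then show ?case by (simp add: low_vanishing_def)
next
  case (Suc m)
  then show ?case using low_vanishing_mult[of 1 p m "p ^ m"] by simp
qed

section \<open>Polynomials and their values\<close>

lemma eval_mpoly_zero: "eval_mpoly (\<lambda>_. 0) p = Poly_Mapping.lookup p {#}"
proof -
  have "eval_mpoly (\<lambda>_. 0) p = (\<Sum>e\<in>insert {#} (Poly_Mapping.keys p). Poly_Mapping.lookup p e * \<Prod>\<^sub># (image_mset (\<lambda>_. 0) e))"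
    by (subst insertion_superset) auto
  also have "\<dots> = (\<Sum>e\<in>{{#}}. Poly_Mapping.lookup p e * \<Prod>\<^sub># (image_mset (\<lambda>_. 0) e))"
    by (rule sum.mono_neutral_right) (auto simp: power_0_left split: if_splits)
  finally show ?thesis by simp
qed

lemma prod_mset_fun_upd:
  fixes z :: "'x \<Rightarrow> 'a::comm_ring_1"
  shows "\<Prod>\<^sub># (image_mset (z(x := t)) e) = t ^ count e x * \<Prod>\<^sub># (image_mset z (filter_mset (\<lambda>y. y \<noteq> x) e))"
  by (induction e) (auto simp: mult_ac)

text \<open>Induction on the set of variables. With all variables but \<open>x\<close> fixed, the
  sum is a univariate polynomial in the value \<open>t\<close> of \<open>x\<close>. It vanishes at
  every \<open>t\<close>, and the ring is an infinite domain, so each coefficient is zero; the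
  coefficient of \<open>t ^ k\<close> is a relation among monomials in the remaining
  variables.\<close>

lemma monomial_functions_independent:
  fixes c :: "'x multiset \<Rightarrow> 'a::{idom, ring_char_0}"
  assumes "finite X" "finite E" "\<And>e. e \<in> E \<Longrightarrow> set_mset e \<subseteq> X"
    and "\<And>z. (\<Sum>e\<in>E. c e * \<Prod>\<^sub># (image_mset z e)) = 0" and "e \<in> E"
  shows "c e = 0"
  using assms
proof (induction X arbitrary: E c e rule: finite_induct)
  case empty
  then have "E = {{#}}" by auto
  then show ?case using empty.prems(3)[of undefined] empty.prems(4) by simp
next
  case (insert x X)
  define r where "r = (\<lambda>e :: 'x multiset. filter_mset (\<lambda>y. y \<noteq> x) e)"
  define k where "k = count e x"
  \<comment> \<open>The exponent of \<open>x\<close> is constant on \<open>E'\<close>, so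
    \<open>r\<close>, which deletes \<open>x\<close>, is injective there and no two terms of the
    relation merge.\<close>
  define E' where "E' = {e \<in> E. count e x = k}"
  have r_inv: "r e + replicate_mset (count e x) x = e" for e
    by (rule multiset_eqI) (auto simp: r_def)
  have inj: "inj_on r E'"
    by (rule inj_onI) (metis (mono_tags, lifting) E'_def mem_Collect_eq r_inv)
  have "c (r e + replicate_mset k x) = 0"
  proof (rule insert.IH[where E = "r ` E'" and c = "\<lambda>e. c (e + replicate_mset k x)"])
    show "finite (r ` E')" using insert.prems by (simp add: E'_def)
    show "set_mset e \<subseteq> X" if "e \<in> r ` E'" for e
      using that insert.prems(2) by (fastforce simp: r_def E'_def)
    show "r e \<in> r ` E'" using insert.prems by (auto simp: E'_def k_def)
    fix z :: "'x \<Rightarrow> 'a"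
    define P where "P = (\<Sum>e\<in>E. monom (c e * \<Prod>\<^sub># (image_mset z (r e))) (count e x))"
    have "poly P t = 0" for t
      using insert.prems(3)[of "z(x := t)"] unfolding prod_mset_fun_upd
      by (simp add: P_def poly_sum poly_monom r_def mult_ac)
    then have "P = 0" using poly_all_0_iff_0 by blast
    then have "coeff P k = 0" by simp
    also have "coeff P k = (\<Sum>e\<in>E'. c e * \<Prod>\<^sub># (image_mset z (r e)))"
      using insert.prems(1)
      by (auto simp: P_def coeff_sum E'_def sum.If_cases Int_def intro!: sum.cong)
    also have "\<dots> = (\<Sum>e\<in>r ` E'. c (e + replicate_mset k x) * \<Prod>\<^sub># (image_mset z e))"
      unfolding sum.reindex[OF inj] by (rule sum.cong) (use r_inv in \<open>auto simp: E'_def\<close>)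
    finally show "(\<Sum>e\<in>r ` E'. c (e + replicate_mset k x) * \<Prod>\<^sub># (image_mset z e)) = 0" .
  qed
  then show ?case by (simp add: k_def r_inv)
qed

lemma mpoly_eq_0_if_eval_eq_0:
  fixes p :: "('x, 'a::{idom, ring_char_0}) mpoly"
  assumes "\<And>z. eval_mpoly z p = 0"
  shows "p = 0"
proof (rule poly_mapping_eqI)
  fix e
  have "Poly_Mapping.lookup p e = 0" if "e \<in> Poly_Mapping.keys p"
    by (rule monomial_functions_independent[where E = "Poly_Mapping.keys p"
          and X = "\<Union>e\<in>Poly_Mapping.keys p. set_mset e" and c = "Poly_Mapping.lookup p"])
      (use assms that in \<open>auto simp: insertion_def\<close>)
  then show "Poly_Mapping.lookup p e = Poly_Mapping.lookup 0 e"
    by (auto simp: in_keys_iff)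
qed

text \<open>This lifts identities that hold at every point to identities of polynomials, whose
  coefficients can then be compared.\<close>

lemma mpoly_eq_if_eval_eq:
  fixes p q :: "('x, 'a::{idom, ring_char_0}) mpoly"
  assumes "\<And>z. eval_mpoly z p = eval_mpoly z q"
  shows "p = q"
proof -
  have "p - q = 0"
  proof (rule mpoly_eq_0_if_eval_eq_0)
    fix z
    interpret comm_ring_hom "eval_mpoly z :: ('x, 'a) mpoly \<Rightarrow> 'a" by (rule comm_ring_hom_eval_mpoly)
    show "eval_mpoly z (p - q) = 0" using assms by (simp add: hom_minus)
  qed
  then show ?thesis by simp
qed

text \<open>Cofactors are signed determinants of submatrices, and determinants commute with ring
  homomorphisms.\<close>

lemma (in comm_ring_hom) map_mat_adj_mat:
  assumes "A \<in> carrier_mat n n"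
  shows "map_mat hom (adj_mat A) = adj_mat (map_mat hom A)"
proof (rule eq_matI)
  fix i j assume "i < dim_row (adj_mat (map_mat hom A))" "j < dim_col (adj_mat (map_mat hom A))"
  then have ij: "i < n" "j < n" using assms by (auto simp: adj_mat_def)
  have "mat_delete (map_mat hom A) j i = map_mat hom (mat_delete A j i)"
    using assms ij by (intro eq_matI) (auto simp: mat_delete_def)
  then have "cofactor (map_mat hom A) j i = hom (cofactor A j i)"
    by (simp add: cofactor_def hom_distribs)
  then show "map_mat hom (adj_mat A) $$ (i, j) = adj_mat (map_mat hom A) $$ (i, j)"
    using ij assms by (simp add: adj_mat_def)
qed (use assms in \<open>auto simp: adj_mat_def\<close>)

abbreviation const_mpoly :: "'a \<Rightarrow> ('x, 'a::comm_ring_1) mpoly" where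
  "const_mpoly \<equiv> Poly_Mapping.single {#}"

lemma eval_mpoly_const [simp]: "eval_mpoly z (const_mpoly c) = c"
  by (simp add: insertion_single)

lemma map_mat_eval_const [simp]: "map_mat (eval_mpoly z) (map_mat const_mpoly A) = A"
  by (intro eq_matI) auto

section \<open>Factoring a polynomial matrix through its maximal compression\<close>

text \<open>At every point where \<open>f\<close> does not vanish,
  \<open>adj_mat_compression\<close> gives \<open>f A = L K\<close> with \<open>L = A D\<close> and
  \<open>K = adj(M) C A\<close>. Since \<open>f\<close> has constant term 1, it can be cancelled up
  to any given degree.\<close>

lemma factorization_up_to_degree:
  fixes A :: "('x, 'a::field_char_0) mpoly mat"
  assumes A: "A \<in> carrier_mat p q" and C: "C \<in> carrier_mat s p" and D: "D \<in> carrier_mat q s"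
    and one: "C * map_mat (eval_mpoly (\<lambda>_. 0)) A * D = 1\<^sub>m s"
    and max: "\<And>z. \<not> compresses_to_one (map_mat (eval_mpoly z) A) (Suc s)"
  obtains L R where "L \<in> carrier_mat p s" "R \<in> carrier_mat s q"
    "\<And>i j e. i < p \<Longrightarrow> j < q \<Longrightarrow> size e \<le> N \<Longrightarrow>
       Poly_Mapping.lookup (A $$ (i, j)) e = Poly_Mapping.lookup ((L * R) $$ (i, j)) e"
proof -
  let ?c = "map_mat const_mpoly :: 'a mat \<Rightarrow> ('x, 'a) mpoly mat"
  define M where "M = ?c C * A * ?c D"
  define f where "f = det M"
  define g where "g = 1 - f"
  text \<open>\<open>h\<close> is an inverse of \<open>f\<close> up to degree \<open>N\<close>, and \<open>R\<close> is a truncation of \<open>f\<^sup>-\<^sup>1 adj(M) C A\<close>.\<close>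
  define h where "h = (\<Sum>i<Suc N. g ^ i)"
  define K where "K = adj_mat M * ?c C * A"
  define L where "L = A * ?c D"
  define R where "R = (h * h * f) \<cdot>\<^sub>m K"
  have M: "M \<in> carrier_mat s s" using A C D by (auto simp: M_def)
  have adj: "adj_mat M \<in> carrier_mat s s" by (rule adj_mat(1)[OF M])
  have K: "K \<in> carrier_mat s q" using A C adj by (auto simp: K_def)
  have L: "L \<in> carrier_mat p s" and R: "R \<in> carrier_mat s q" using A D K by (auto simp: L_def R_def)
  have ev_M: "map_mat (eval_mpoly z) M = C * map_mat (eval_mpoly z) A * D" for z
  proof -
    interpret comm_ring_hom "eval_mpoly z :: ('x, 'a) mpoly \<Rightarrow> 'a" by (rule comm_ring_hom_eval_mpoly)
    show ?thesis
      using A C D mat_hom_mult[of "?c C * A" s q "?c D" s] mat_hom_mult[of "?c C" s p A q]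
      by (simp add: M_def del: assoc_mult_mat)
  qed
  have ev_f: "eval_mpoly z f = det (C * map_mat (eval_mpoly z) A * D)" for z
  proof -
    interpret comm_ring_hom "eval_mpoly z :: ('x, 'a) mpoly \<Rightarrow> 'a" by (rule comm_ring_hom_eval_mpoly)
    show ?thesis unfolding f_def hom_det[symmetric] ev_M ..
  qed
  have ev_LK: "map_mat (eval_mpoly z) (L * K) =
      map_mat (eval_mpoly z) A * D * adj_mat (C * map_mat (eval_mpoly z) A * D) * C * map_mat (eval_mpoly z) A" for z
  proof -
    interpret comm_ring_hom "eval_mpoly z :: ('x, 'a) mpoly \<Rightarrow> 'a" by (rule comm_ring_hom_eval_mpoly)
    let ?A = "map_mat (eval_mpoly z) A"
    have "map_mat (eval_mpoly z) M \<in> carrier_mat s s" using M by simp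
    then have adj': "adj_mat (C * ?A * D) \<in> carrier_mat s s" unfolding ev_M by (rule adj_mat(1))
    have "map_mat (eval_mpoly z) (L * K) = (?A * D) * (adj_mat (C * ?A * D) * C * ?A)"
      using A C D L K adj mat_hom_mult[OF L K] mat_hom_mult[of A p q "?c D" s]
        mat_hom_mult[of "adj_mat M * ?c C" s p A q] mat_hom_mult[of "adj_mat M" s s "?c C" p]
      by (simp add: L_def K_def map_mat_adj_mat[OF M] ev_M del: assoc_mult_mat)
    also have "\<dots> = ?A * D * adj_mat (C * ?A * D) * C * ?A"
      using A C D adj' assoc_mult_mat[of "?A * D" p s "adj_mat (C * ?A * D) * C" p ?A q]
        assoc_mult_mat[of "?A * D" p s "adj_mat (C * ?A * D)" s C p]
      by (simp del: assoc_mult_mat)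
    finally show ?thesis .
  qed
  text \<open>The extra factor \<open>f\<close> takes care of the points at which \<open>M\<close> is singular.\<close>
  have key: "f * f * A $$ (i, j) = f * (L * K) $$ (i, j)" if ij: "i < p" "j < q" for i j
  proof (rule mpoly_eq_if_eval_eq)
    fix z
    interpret comm_ring_hom "eval_mpoly z :: ('x, 'a) mpoly \<Rightarrow> 'a" by (rule comm_ring_hom_eval_mpoly)
    have LK: "eval_mpoly z ((L * K) $$ (i, j)) = map_mat (eval_mpoly z) (L * K) $$ (i, j)"
      using ij L K by (simp del: index_mult_mat(1))
    show "eval_mpoly z (f * f * A $$ (i, j)) = eval_mpoly z (f * (L * K) $$ (i, j))"
    proof (cases "eval_mpoly z f = 0")
      case True
      then show ?thesis by (simp add: hom_mult)
    next
      case False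
      have "det (C * map_mat (eval_mpoly z) A * D) \<cdot>\<^sub>m map_mat (eval_mpoly z) A = map_mat (eval_mpoly z) (L * K)"
        unfolding ev_LK by (rule adj_mat_compression[OF _ C D max]) (use A False ev_f in auto)
      then have "eval_mpoly z f * eval_mpoly z (A $$ (i, j)) = map_mat (eval_mpoly z) (L * K) $$ (i, j)"
        using A ij by (auto simp: ev_f dest!: arg_cong[where f = "\<lambda>X. X $$ (i, j)"])
      then show ?thesis by (simp only: hom_mult LK mult.assoc)
    qed
  qed
  \<comment> \<open>At the origin \<open>M\<close> is the identity by assumption \<open>one\<close>,
    so \<open>f\<close> has constant term 1 and \<open>g = 1 - f\<close> has none.\<close>
  have "low_vanishing 1 g"
  proof -
    have "Poly_Mapping.lookup f {#} = 1"
      using ev_f[of "\<lambda>_. 0"] by (simp add: one eval_mpoly_zero del: assoc_mult_mat)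
    then show ?thesis by (auto simp: low_vanishing_def g_def lookup_minus)
  qed
  then have g_pow: "low_vanishing (Suc N) (g ^ Suc N)" by (rule low_vanishing_power)
  have hf: "h * f = 1 - g ^ Suc N"
    using one_diff_power_eq[of g "Suc N"] by (simp add: h_def g_def mult.commute)
  \<comment> \<open>By \<open>key\<close>, \<open>L * R\<close> is \<open>(h * f)\<close> squared
    times \<open>A\<close>, entry by entry. As \<open>h * f = 1 - g ^ Suc N\<close>, the error is
    \<open>1 - (1 - g ^ Suc N)^2\<close> times \<open>A\<close>, which is divisible by
    \<open>g ^ Suc N\<close>.\<close>
  have "A $$ (i, j) - (L * R) $$ (i, j) = g ^ Suc N * ((2 - g ^ Suc N) * A $$ (i, j))"
    if ij: "i < p" "j < q" for i j
  proof -
    have "(L * R) $$ (i, j) = h * h * f * (L * K) $$ (i, j)"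
      using ij L K mult_smult_distrib[OF L K, of "h * h * f"] by (simp add: R_def del: index_mult_mat(1))
    also have "\<dots> = h * h * (f * (L * K) $$ (i, j))" by (simp only: mult.assoc)
    also have "\<dots> = h * h * (f * f * A $$ (i, j))" by (simp only: key[OF ij])
    also have "\<dots> = (h * f) * (h * f) * A $$ (i, j)" by (simp only: mult_ac)
    finally show ?thesis unfolding hf by (simp add: algebra_simps)
  qed
  then have "low_vanishing (Suc N) (A $$ (i, j) - (L * R) $$ (i, j))" if "i < p" "j < q" for i j
    using that low_vanishing_mult_left[OF g_pow] by simp
  then have "Poly_Mapping.lookup (A $$ (i, j)) e = Poly_Mapping.lookup ((L * R) $$ (i, j)) e"
    if "i < p" "j < q" "size e \<le> N" for i j e
    using that by (force simp: low_vanishing_def lookup_minus)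
  with L R show thesis by (rule that)
qed

section \<open>Rank of linear combinations of coefficients of a product\<close>

lemma index_mult_mat_sum:
  assumes "L \<in> carrier_mat p s" "R \<in> carrier_mat s q" "i < p" "j < q"
  shows "(L * R) $$ (i, j) = (\<Sum>k<s. L $$ (i, k) * R $$ (k, j))"
  using assms by (auto simp: scalar_prod_def lessThan_atLeast0 intro!: sum.cong)

text \<open>The coefficient of \<open>L * R\<close> at \<open>e\<close> is the sum of
  \<open>L_a * R_b\<close> over \<open>a + b = e\<close>. Since \<open>size e \<le> t1 + t2\<close>,
  either \<open>size a \<le> t1\<close> or \<open>size b < t2\<close>. Terms of the first kind are
  grouped by \<open>a\<close>, the others by \<open>b\<close>; each group is a product with inner
  dimension \<open>s\<close>, that is, \<open>s\<close> outer products. Closure of \<open>E\<close>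
  under submultisets puts \<open>a\<close> and \<open>b\<close> into \<open>E\<close>.\<close>

lemma rank_coefficient_combination_product:
  fixes L R :: "('x, 'a::field) mpoly mat" and l :: "'x multiset \<Rightarrow> 'a"
  assumes L: "L \<in> carrier_mat p s" and R: "R \<in> carrier_mat s q"
    and E: "finite E" "\<And>a e. e \<in> E \<Longrightarrow> a \<subseteq># e \<Longrightarrow> a \<in> E" "\<And>e. e \<in> E \<Longrightarrow> size e \<le> t1 + t2"
  shows "vec_space.rank p (mat p q (\<lambda>(i, j). \<Sum>e\<in>E. l e * Poly_Mapping.lookup ((L * R) $$ (i, j)) e))
    \<le> s * (card {e \<in> E. size e \<le> t1} + card {e \<in> E. size e < t2})" (is "vec_space.rank p ?T \<le> _")
proof -
  let ?Y = "{e \<in> E. size e \<le> t1}" and ?Z = "{e \<in> E. size e < t2}"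
  let ?L = "\<lambda>i k a. Poly_Mapping.lookup (L $$ (i, k)) a" and ?R = "\<lambda>k j b. Poly_Mapping.lookup (R $$ (k, j)) b"
  define w where "w = (\<lambda>(k, a) j. \<Sum>e | e \<in> E \<and> a \<subseteq># e. l e * ?R k j (e - a))"
  \<comment> \<open>The condition \<open>t1 < size (e - b)\<close> leaves out the pairs already
    collected in \<open>w\<close>, so that no pair is counted twice.\<close>
  define u where "u = (\<lambda>(k, b) i. \<Sum>e | e \<in> E \<and> b \<subseteq># e \<and> t1 < size (e - b). l e * ?L i k (e - b))"
  define T1 where "T1 = mat p q (\<lambda>(i, j). \<Sum>x\<in>{..<s} \<times> ?Y. (case x of (k, a) \<Rightarrow> ?L i k a) * w x j)"
  define T2 where "T2 = mat p q (\<lambda>(i, j). \<Sum>x\<in>{..<s} \<times> ?Z. u x i * (case x of (k, b) \<Rightarrow> ?R k j b))"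
  have T1: "T1 \<in> carrier_mat p q" and T2: "T2 \<in> carrier_mat p q" by (auto simp: T1_def T2_def)
  have size_sub: "size a + size (e - a) = size e" if "a \<subseteq># e" for a e :: "'x multiset"
    using that by (metis size_union subset_mset.add_diff_inverse)
  have diff_diff: "e - (e - a) = a" if "a \<subseteq># e" for a e :: "'x multiset"
    using that by (metis add_diff_cancel_right' subset_mset.add_diff_inverse)
  have split: "(\<Sum>e\<in>E. l e * (\<Sum>a | a \<subseteq># e. ?L i k a * ?R k j (e - a))) =
      (\<Sum>a\<in>?Y. ?L i k a * w (k, a) j) + (\<Sum>b\<in>?Z. u (k, b) i * ?R k j b)" for i j k
  proof -
    have inner: "(\<Sum>a | a \<subseteq># e. ?L i k a * ?R k j (e - a)) =
      (\<Sum>a | a \<in> ?Y \<and> a \<subseteq># e. ?L i k a * ?R k j (e - a)) +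
      (\<Sum>b | b \<in> ?Z \<and> b \<subseteq># e \<and> t1 < size (e - b). ?L i k (e - b) * ?R k j b)" if e: "e \<in> E" for e
    proof -
      have "(\<Sum>a | a \<subseteq># e. ?L i k a * ?R k j (e - a)) =
        (\<Sum>a | a \<subseteq># e \<and> size a \<le> t1. ?L i k a * ?R k j (e - a)) + (\<Sum>a | a \<subseteq># e \<and> \<not> size a \<le> t1. ?L i k a * ?R k j (e - a))"
        by (subst sum.union_disjoint[symmetric])
          (auto intro: finite_subset[OF _ finite_subset_mset[of e]] intro!: sum.cong)
      also have "{a. a \<subseteq># e \<and> size a \<le> t1} = {a. a \<in> ?Y \<and> a \<subseteq># e}" using E(2)[OF e] by auto
      also have "(\<Sum>a | a \<subseteq># e \<and> \<not> size a \<le> t1. ?L i k a * ?R k j (e - a)) =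
          (\<Sum>b | b \<in> ?Z \<and> b \<subseteq># e \<and> t1 < size (e - b). ?L i k (e - b) * ?R k j b)"
      \<comment> \<open>Passing to the complementary factor \<open>b = e - a\<close>: if
        \<open>size a\<close> exceeds \<open>t1\<close>, then \<open>size b\<close> is strictly
        below \<open>t2\<close>.\<close>
      proof (rule sum.reindex_bij_witness[of _ "\<lambda>b. e - b" "\<lambda>a. e - a"])
        fix a assume a: "a \<in> {a. a \<subseteq># e \<and> \<not> size a \<le> t1}"
        then have ea: "e - (e - a) = a" by (simp add: diff_diff)
        then show "e - (e - a) = a" .
        have "size (e - a) < t2" using a size_sub[of a e] E(3)[OF e] by auto
        then show "e - a \<in> {b. b \<in> ?Z \<and> b \<subseteq># e \<and> t1 < size (e - b)}"
          using a ea E(2)[OF e, of "e - a"] by auto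
        show "?L i k (e - (e - a)) * ?R k j (e - a) = ?L i k a * ?R k j (e - a)" by (simp add: ea)
      next
        fix b assume b: "b \<in> {b. b \<in> ?Z \<and> b \<subseteq># e \<and> t1 < size (e - b)}"
        then show "e - (e - b) = b" by (simp add: diff_diff)
        show "e - b \<in> {a. a \<subseteq># e \<and> \<not> size a \<le> t1}" using b by auto
      qed
      finally show ?thesis .
    qed
    have "(\<Sum>e\<in>E. l e * (\<Sum>a | a \<subseteq># e. ?L i k a * ?R k j (e - a))) =
      (\<Sum>e\<in>E. \<Sum>a | a \<in> ?Y \<and> a \<subseteq># e. l e * (?L i k a * ?R k j (e - a))) +
      (\<Sum>e\<in>E. \<Sum>b | b \<in> ?Z \<and> b \<subseteq># e \<and> t1 < size (e - b). l e * (?L i k (e - b) * ?R k j b))"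
      by (simp add: inner distrib_left sum.distrib sum_distrib_left)
    also have "(\<Sum>e\<in>E. \<Sum>a | a \<in> ?Y \<and> a \<subseteq># e. l e * (?L i k a * ?R k j (e - a))) =
        (\<Sum>a\<in>?Y. \<Sum>e | e \<in> E \<and> a \<subseteq># e. l e * (?L i k a * ?R k j (e - a)))"
      by (rule sum.swap_restrict) (use E in auto)
    also have "\<dots> = (\<Sum>a\<in>?Y. ?L i k a * w (k, a) j)"
      by (simp add: w_def sum_distrib_left mult_ac)
    also have "(\<Sum>e\<in>E. \<Sum>b | b \<in> ?Z \<and> b \<subseteq># e \<and> t1 < size (e - b). l e * (?L i k (e - b) * ?R k j b)) =
        (\<Sum>b\<in>?Z. \<Sum>e | e \<in> E \<and> b \<subseteq># e \<and> t1 < size (e - b). l e * (?L i k (e - b) * ?R k j b))"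
      by (rule sum.swap_restrict) (use E in auto)
    also have "\<dots> = (\<Sum>b\<in>?Z. u (k, b) i * ?R k j b)"
      by (simp add: u_def sum_distrib_right mult.assoc)
    finally show ?thesis .
  qed
  have "?T = T1 + T2"
  proof (rule eq_matI)
    fix i j assume "i < dim_row (T1 + T2)" "j < dim_col (T1 + T2)"
    then have ij: "i < p" "j < q" using T2 by auto
    have "?T $$ (i, j) = (\<Sum>e\<in>E. l e * (\<Sum>k<s. \<Sum>a | a \<subseteq># e. ?L i k a * ?R k j (e - a)))"
      using ij by (simp add: index_mult_mat_sum[OF L R] lookup_sum lookup_mult_mset del: index_mult_mat)
    also have "\<dots> = (\<Sum>k<s. \<Sum>e\<in>E. l e * (\<Sum>a | a \<subseteq># e. ?L i k a * ?R k j (e - a)))"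
      unfolding sum_distrib_left by (rule sum.swap)
    also have "\<dots> = (\<Sum>k<s. \<Sum>a\<in>?Y. ?L i k a * w (k, a) j) + (\<Sum>k<s. \<Sum>b\<in>?Z. u (k, b) i * ?R k j b)"
      by (simp only: split sum.distrib)
    also have "\<dots> = (T1 + T2) $$ (i, j)"
      using ij by (simp add: T1_def T2_def sum.cartesian_product split_def)
    finally show "?T $$ (i, j) = (T1 + T2) $$ (i, j)" .
  qed (use T2 in auto)
  then have "vec_space.rank p ?T \<le> vec_space.rank p T1 + vec_space.rank p T2"
    using vec_space.rank_subadditive[OF T1 T2] by simp
  also have "vec_space.rank p T1 \<le> card ({..<s} \<times> ?Y)"
    by (rule rank_le_card_summands[OF _ T1]) (use E in \<open>auto simp: T1_def\<close>)
  also have "vec_space.rank p T2 \<le> card ({..<s} \<times> ?Z)"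
    by (rule rank_le_card_summands[OF _ T2]) (use E in \<open>auto simp: T2_def\<close>)
  finally show ?thesis by (simp add: card_cartesian_product distrib_left)
qed

section \<open>Translations of polynomials\<close>

lemma (in comm_ring_hom) hom_insertion:
  "hom (insertion h g p) = insertion (hom \<circ> h) (hom \<circ> g) p"
proof -
  have "hom (\<Prod>\<^sub># (image_mset g e)) = \<Prod>\<^sub># (image_mset (hom \<circ> g) e)" for e
    by (induction e) (auto simp: hom_mult)
  then show ?thesis by (simp add: insertion_def hom_sum hom_mult)
qed

definition shift_mpoly :: "('x \<Rightarrow> 'a::comm_ring_1) \<Rightarrow> ('x, 'a) mpoly \<Rightarrow> ('x, 'a) mpoly" where
  "shift_mpoly c = insertion const_mpoly (\<lambda>x. Poly_Mapping.single {#x#} 1 + const_mpoly (c x))"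

lemma comm_ring_hom_shift_mpoly: "comm_ring_hom (shift_mpoly c)"
  unfolding shift_mpoly_def by (rule comm_ring_hom.comm_ring_hom_insertion[OF comm_ring_hom_single])

lemma eval_shift_mpoly: "eval_mpoly z (shift_mpoly c p) = eval_mpoly (\<lambda>x. z x + c x) p"
proof -
  interpret comm_ring_hom "eval_mpoly z :: ('b, 'a) mpoly \<Rightarrow> 'a" by (rule comm_ring_hom_eval_mpoly)
  have "eval_mpoly z \<circ> const_mpoly = id" by auto
  moreover have "eval_mpoly z \<circ> (\<lambda>x. Poly_Mapping.single {#x#} 1 + const_mpoly (c x)) = (\<lambda>x. z x + c x)"
    by (auto simp: hom_add insertion_single)
  ultimately show ?thesis by (simp add: shift_mpoly_def hom_insertion)
qed

text \<open>Both sides take the same values, because translating the argument by \<open>c\<close>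
  and by \<open>- c\<close> cancels.\<close>

lemma shift_mpoly_uminus:
  fixes p :: "('x, 'a::{idom, ring_char_0}) mpoly"
  shows "shift_mpoly (\<lambda>x. - c x) (shift_mpoly c p) = p"
  by (rule mpoly_eq_if_eval_eq) (simp add: eval_shift_mpoly)

text \<open>Expanding the product of the factors \<open>x + c x\<close> over a monomial
  \<open>e\<close> yields only divisors of \<open>e\<close>, and \<open>E\<close> is closed under
  divisors.\<close>

lemma keys_shift_mpoly:
  fixes p :: "('x, 'a::comm_ring_1) mpoly"
  assumes "Poly_Mapping.keys p \<subseteq> E" "\<And>a e. e \<in> E \<Longrightarrow> a \<subseteq># e \<Longrightarrow> a \<in> E"
  shows "Poly_Mapping.keys (shift_mpoly c p) \<subseteq> E"
proof -
  have keys_prod: "Poly_Mapping.keys (\<Prod>\<^sub># (image_mset (\<lambda>x. Poly_Mapping.single {#x#} 1 + const_mpoly (c x)) e)) \<subseteq> {a. a \<subseteq># e}" for e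
  proof (induction e)
    case (add x e)
    have "Poly_Mapping.keys (Poly_Mapping.single {#x#} 1 + const_mpoly (c x)) \<subseteq> {{#x#}, {#}}"
      by (rule order.trans[OF Poly_Mapping.keys_add]) auto
    then have "a + b \<subseteq># add_mset x e"
      if "a \<in> Poly_Mapping.keys (Poly_Mapping.single {#x#} 1 + const_mpoly (c x))" "b \<subseteq># e" for a b
    proof -
      have "a + b \<subseteq># {#x#} + e"
        by (rule subset_mset.add_mono) (use that \<open>_ \<subseteq> {{#x#}, {#}}\<close> in auto)
      then show ?thesis by simp
    qed
    then show ?case
      using add keys_mult by (fastforce dest!: subsetD[OF keys_mult])
  qed (simp add: keys_one)
  show ?thesis
  proof
    fix a assume "a \<in> Poly_Mapping.keys (shift_mpoly c p)"
    then have "Poly_Mapping.lookup (shift_mpoly c p) a \<noteq> 0" by (simp add: in_keys_iff)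
    then obtain e where e: "e \<in> Poly_Mapping.keys p"
      and "Poly_Mapping.lookup (const_mpoly (Poly_Mapping.lookup p e) *
          \<Prod>\<^sub># (image_mset (\<lambda>x. Poly_Mapping.single {#x#} 1 + const_mpoly (c x)) e)) a \<noteq> 0"
      unfolding shift_mpoly_def insertion_def lookup_sum by (meson sum.not_neutral_contains_not_neutral)
    then have "a \<in> Poly_Mapping.keys (const_mpoly (Poly_Mapping.lookup p e) *
          \<Prod>\<^sub># (image_mset (\<lambda>x. Poly_Mapping.single {#x#} 1 + const_mpoly (c x)) e))"
      by (simp add: in_keys_iff)
    then obtain b b' where "a = b + b'" "b \<in> Poly_Mapping.keys (const_mpoly (Poly_Mapping.lookup p e) :: ('x, 'a) mpoly)" "b' \<subseteq># e"
      using keys_mult keys_prod by blast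
    then have "a \<subseteq># e" by (auto split: if_splits)
    then show "a \<in> E" using assms e by blast
  qed
qed

text \<open>A point \<open>z0\<close> with the largest compression, of size
  \<open>s \<le> r\<close>, is moved to the origin, where \<open>factorization_up_to_degree\<close>
  applies. Translating back is linear on polynomials supported in \<open>E\<close>, so a combination
  of coefficients of \<open>A\<close> is also a combination of coefficients of the translate
  \<open>B\<close>, and these agree with those of \<open>L * R\<close> in the relevant
  degrees.\<close>

lemma rank_coefficient_combination:
  fixes A :: "('x, 'a::field_char_0) mpoly mat" and l :: "'x multiset \<Rightarrow> 'a"
  assumes A: "A \<in> carrier_mat p q"
    and rank: "\<And>z. vec_space.rank p (map_mat (eval_mpoly z) A) \<le> r"
    and keys: "\<And>i j. i < p \<Longrightarrow> j < q \<Longrightarrow> Poly_Mapping.keys (A $$ (i, j)) \<subseteq> E"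
    and E: "finite E" "\<And>a e. e \<in> E \<Longrightarrow> a \<subseteq># e \<Longrightarrow> a \<in> E" "\<And>e. e \<in> E \<Longrightarrow> size e \<le> t1 + t2"
  shows "vec_space.rank p (mat p q (\<lambda>(i, j). \<Sum>e\<in>E. l e * Poly_Mapping.lookup (A $$ (i, j)) e))
    \<le> r * (card {e \<in> E. size e \<le> t1} + card {e \<in> E. size e < t2})"
proof -
  define S where "S = {s. \<exists>z. compresses_to_one (map_mat (eval_mpoly z) A) s}"
  have S_le: "s \<le> r" if "s \<in> S" for s
    using that compresses_to_one_le_rank[of "map_mat (eval_mpoly _) A" p q s] rank A
    unfolding S_def by (force intro: order.trans)
  then have fin: "finite S" by (meson finite_nat_set_iff_bounded_le)
  \<comment> \<open>The empty compression exists at every point, so the maximum below is taken over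
    a nonempty set.\<close>
  have "0 \<in> S"
    unfolding S_def compresses_to_one_def
    by (intro CollectI exI[of _ undefined] exI[of _ "0\<^sub>m 0 _"] exI[of _ "0\<^sub>m _ 0"]) (auto intro!: eq_matI)
  then have "S \<noteq> {}" by auto
  define s where "s = Max S"
  have "s \<in> S" using fin \<open>S \<noteq> {}\<close> by (simp add: s_def)
  have max: "\<not> compresses_to_one (map_mat (eval_mpoly z) A) (Suc s)" for z
  proof
    assume "compresses_to_one (map_mat (eval_mpoly z) A) (Suc s)"
    then have "Suc s \<in> S" by (auto simp: S_def)
    then show False using Max_ge[OF fin] s_def by fastforce
  qed
  obtain z0 where "compresses_to_one (map_mat (eval_mpoly z0) A) s" using \<open>s \<in> S\<close> by (auto simp: S_def)
  then obtain C D where C: "C \<in> carrier_mat s p" and D: "D \<in> carrier_mat q s"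
    and one: "C * map_mat (eval_mpoly z0) A * D = 1\<^sub>m s"
    using A by (auto simp: compresses_to_one_def)
  define B where "B = map_mat (shift_mpoly z0) A"
  have B: "B \<in> carrier_mat p q" using A by (simp add: B_def)
  have ev_B: "map_mat (eval_mpoly z) B = map_mat (eval_mpoly (\<lambda>x. z x + z0 x)) A" for z
    by (intro eq_matI) (auto simp: B_def eval_shift_mpoly)
  have keys_B: "Poly_Mapping.keys (B $$ (i, j)) \<subseteq> E" if "i < p" "j < q" for i j
    using keys_shift_mpoly[of "A $$ (i, j)" E z0] keys[OF that] E(2) that A by (simp add: B_def)
  obtain L R where L: "L \<in> carrier_mat p s" and R: "R \<in> carrier_mat s q"
    and LR: "\<And>i j e. i < p \<Longrightarrow> j < q \<Longrightarrow> size e \<le> t1 + t2 \<Longrightarrow>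
       Poly_Mapping.lookup (B $$ (i, j)) e = Poly_Mapping.lookup ((L * R) $$ (i, j)) e"
    by (rule factorization_up_to_degree[OF B C D, where N = "t1 + t2"]) (use one max in \<open>simp_all add: ev_B\<close>)
  define \<Lambda> where "\<Lambda> = (\<lambda>f :: ('x, 'a) mpoly. \<Sum>e\<in>E. l e * Poly_Mapping.lookup f e)"
  \<comment> \<open>The weights of the functional \<open>\<Lambda>\<close> composed with the
    translation back by \<open>- z0\<close>, read off on the monomials of \<open>E\<close>.\<close>
  define l' where "l' = (\<lambda>e. \<Lambda> (shift_mpoly (\<lambda>x. - z0 x) (Poly_Mapping.single e 1)))"
  interpret shift: comm_ring_hom "shift_mpoly (\<lambda>x. - z0 x) :: ('x, 'a) mpoly \<Rightarrow> _" by (rule comm_ring_hom_shift_mpoly)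
  have "\<Lambda> (A $$ (i, j)) = (\<Sum>e\<in>E. l' e * Poly_Mapping.lookup ((L * R) $$ (i, j)) e)" if ij: "i < p" "j < q" for i j
  proof -
    let ?b = "Poly_Mapping.lookup (B $$ (i, j))"
    have \<Lambda>_sum: "\<Lambda> (sum F X) = (\<Sum>x\<in>X. \<Lambda> (F x))" for F :: "'x multiset \<Rightarrow> ('x, 'a) mpoly" and X
      unfolding \<Lambda>_def lookup_sum sum_distrib_left by (rule sum.swap)
    have \<Lambda>_scale: "\<Lambda> (const_mpoly c * f) = c * \<Lambda> f" for c f
    proof -
      have "Poly_Mapping.lookup (const_mpoly c * f) e = c * Poly_Mapping.lookup f e" for e
      proof -
        have "Poly_Mapping.lookup (const_mpoly c * f) e = (\<Sum>a\<in>{{#}}. Poly_Mapping.lookup (const_mpoly c) a * Poly_Mapping.lookup f (e - a))"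
          unfolding lookup_mult_mset
          by (rule sum.mono_neutral_right) (auto simp: finite_subset_mset lookup_single)
        then show ?thesis by simp
      qed
      then show ?thesis by (simp add: \<Lambda>_def sum_distrib_left mult_ac)
    qed
    have shift_const: "shift_mpoly c (const_mpoly a) = const_mpoly a" for c :: "'x \<Rightarrow> 'a" and a
      by (simp add: shift_mpoly_def insertion_single)
    have "A $$ (i, j) = shift_mpoly (\<lambda>x. - z0 x) (B $$ (i, j))"
      using ij A by (simp add: B_def shift_mpoly_uminus)
    also have "B $$ (i, j) = (\<Sum>e\<in>Poly_Mapping.keys (B $$ (i, j)). Poly_Mapping.single e (?b e))"
      by (rule poly_mapping_sum_single)
    also have "\<dots> = (\<Sum>e\<in>E. const_mpoly (?b e) * Poly_Mapping.single e 1)"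
      by (simp add: mult_single) (rule sum.mono_neutral_left, use E keys_B[OF ij] in \<open>auto simp: in_keys_iff\<close>)
    finally have "A $$ (i, j) = (\<Sum>e\<in>E. const_mpoly (?b e) * shift_mpoly (\<lambda>x. - z0 x) (Poly_Mapping.single e 1))"
      by (simp only: shift.hom_sum shift.hom_mult shift_const)
    then have "\<Lambda> (A $$ (i, j)) = (\<Sum>e\<in>E. l' e * ?b e)"
      by (simp only: \<Lambda>_sum \<Lambda>_scale l'_def) (rule sum.cong[OF refl], rule mult.commute)
    then show ?thesis using LR[OF ij] E(3) by simp
  qed
  then have "mat p q (\<lambda>(i, j). \<Sum>e\<in>E. l e * Poly_Mapping.lookup (A $$ (i, j)) e) =
      mat p q (\<lambda>(i, j). \<Sum>e\<in>E. l' e * Poly_Mapping.lookup ((L * R) $$ (i, j)) e)"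
    by (intro eq_matI) (auto simp: \<Lambda>_def simp del: index_mult_mat)
  then have "vec_space.rank p (mat p q (\<lambda>(i, j). \<Sum>e\<in>E. l e * Poly_Mapping.lookup (A $$ (i, j)) e))
    \<le> s * (card {e \<in> E. size e \<le> t1} + card {e \<in> E. size e < t2})"
    using rank_coefficient_combination_product[OF L R E, where l = l'] by simp
  also have "\<dots> \<le> r * (card {e \<in> E. size e \<le> t1} + card {e \<in> E. size e < t2})"
    using S_le[OF \<open>s \<in> S\<close>] by (rule mult_right_mono) simp
  finally show ?thesis .
qed

section \<open>Application to tensor products of spaces of forms\<close>

text \<open>Additivity is available for two summands only, so the expansion in the basis is built up
  by adding one basis element at a time to the support of a truncation \<open>w B\<close> of
  \<open>v\<close>.\<close>

lemma lin_to_mat_entry: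
  assumes lin: "lin_to_mat n d p q \<phi>" and fin: "finite (Vbasis n d)" and v: "v \<in> Vspace n d" and ij: "i < p" "j < q"
  shows "\<phi> v $$ (i, j) = (\<Sum>b\<in>Vbasis n d. v b * \<phi> (\<lambda>e. if e = b then 1 else 0) $$ (i, j))"
proof -
  define w where "w = (\<lambda>B e. if e \<in> B then v e else 0)"
  have w_V: "w B \<in> Vspace n d" for B using v by (auto simp: w_def Vspace_def)
  have unit_V: "(\<lambda>e. if e = b then 1 else 0) \<in> Vspace n d" if "b \<in> Vbasis n d" for b
    using that by (auto simp: Vspace_def)
  have dims: "\<phi> u \<in> carrier_mat p q" if "u \<in> Vspace n d" for u
    using lin that by (auto simp: lin_to_mat_def)
  have add: "\<phi> (\<lambda>e. u e + u' e) $$ (i, j) = \<phi> u $$ (i, j) + \<phi> u' $$ (i, j)"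
    if "u \<in> Vspace n d" "u' \<in> Vspace n d" for u u'
    using lin that dims[of u] dims[of u'] ij by (auto simp: lin_to_mat_def)
  have scale: "\<phi> (\<lambda>e. a * u e) $$ (i, j) = a * \<phi> u $$ (i, j)" if "u \<in> Vspace n d" for a u
    using lin that dims[of u] ij by (auto simp: lin_to_mat_def)
  have "\<phi> (w B) $$ (i, j) = (\<Sum>b\<in>B. v b * \<phi> (\<lambda>e. if e = b then 1 else 0) $$ (i, j))"
    if "finite B" "B \<subseteq> Vbasis n d" for B
    using that
  proof (induction B rule: finite_induct)
    case empty
    have "w {} = (\<lambda>e. 0 * v e)" by (auto simp: w_def)
    then show ?case using scale[OF v, of 0] by simp
  next
    case (insert b B)
    have eq: "w (insert b B) = (\<lambda>e. v b * (if e = b then 1 else 0) + w B e)"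
      using insert by (auto simp: w_def)
    have "(\<lambda>e. v b * (if e = b then 1 else 0)) \<in> Vspace n d"
      using insert by (auto simp: Vspace_def)
    then have "\<phi> (w (insert b B)) $$ (i, j) = \<phi> (\<lambda>e. v b * (if e = b then 1 else 0)) $$ (i, j) + \<phi> (w B) $$ (i, j)"
      unfolding eq by (rule add[OF _ w_V])
    also have "\<phi> (\<lambda>e. v b * (if e = b then 1 else 0)) $$ (i, j) = v b * \<phi> (\<lambda>e. if e = b then 1 else 0) $$ (i, j)"
      by (rule scale[OF unit_V]) (use insert in auto)
    finally show ?case using insert by simp
  qed
  from this[OF fin] have "\<phi> (w (Vbasis n d)) $$ (i, j) = (\<Sum>b\<in>Vbasis n d. v b * \<phi> (\<lambda>e. if e = b then 1 else 0) $$ (i, j))"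
    by simp
  moreover have "w (Vbasis n d) = v" using v by (auto simp: w_def Vspace_def)
  ultimately show ?thesis by simp
qed

section \<open>Affine monomials and the monomial basis\<close>

definition exponents :: "(nat \<times> nat) multiset \<Rightarrow> nat \<Rightarrow> nat \<Rightarrow> nat" where
  "exponents M i j = count M (i, j)"

text \<open>The monomials counted by \<open>monoms\<close>, as multisets of pairs and without the
  bound on the total degree. They are the basis monomials with every variable of index
  \<open>j = 0\<close> set to 1.\<close>

definition affine_monomials :: "nat list \<Rightarrow> nat list \<Rightarrow> (nat \<times> nat) multiset set" where
  "affine_monomials n d = {M. set_mset M \<subseteq> (SIGMA i:{..<length n}. {1..n ! i}) \<and>
     (\<forall>i<length n. (\<Sum>j\<in>{1..n ! i}. count M (i, j)) \<le> d ! i)}"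

text \<open>The exponent of the variable \<open>(i, 0)\<close> fills block \<open>i\<close> up to
  degree \<open>d ! i\<close>; the truncated subtraction is exact on
  \<open>affine_monomials\<close>.\<close>

definition homogenize :: "nat list \<Rightarrow> nat list \<Rightarrow> (nat \<times> nat) multiset \<Rightarrow> nat \<Rightarrow> nat \<Rightarrow> nat" where
  "homogenize n d M i j = (if i < length n \<and> j = 0 then d ! i - (\<Sum>j\<in>{1..n ! i}. count M (i, j)) else count M (i, j))"

lemma size_eq_sum_count:
  assumes "set_mset M \<subseteq> (SIGMA i:I. J i)" "finite I" "\<And>i. i \<in> I \<Longrightarrow> finite (J i)"
  shows "size M = (\<Sum>i\<in>I. \<Sum>j\<in>J i. count M (i, j))"
proof -
  have "size M = (\<Sum>x\<in>(SIGMA i:I. J i). count M x)"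
    unfolding size_multiset_overloaded_eq
    by (rule sum.mono_neutral_left) (use assms in \<open>auto simp: not_in_iff\<close>)
  then show ?thesis using assms by (simp add: sum.Sigma split_def)
qed

lemma multiset_of_exponents:
  assumes "finite X" "\<And>i j. (i, j) \<notin> X \<Longrightarrow> e i j = 0"
  obtains M where "set_mset M \<subseteq> X" "\<And>i j. count M (i, j) = e i j"
proof
  have fin: "finite {x. 0 < (case x of (i, j) \<Rightarrow> e i j)}"
    by (rule finite_subset[OF _ assms(1)]) (use assms(2) in force)
  define M where "M = Abs_multiset (\<lambda>(i, j). e i j)"
  show c: "count M (i, j) = e i j" for i j unfolding M_def using count_Abs_multiset[OF fin] by simp
  show "set_mset M \<subseteq> X"
  proof
    fix x assume "x \<in># M"
    then have "count M x > 0" by simp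
    then show "x \<in> X" using assms(2) c by (cases x) force
  qed
qed

lemma affine_monomials_subset:
  assumes "M \<in> affine_monomials n d" "M' \<subseteq># M"
  shows "M' \<in> affine_monomials n d"
proof -
  have le: "(\<Sum>j\<in>{1..n ! i}. count M' (i, j)) \<le> (\<Sum>j\<in>{1..n ! i}. count M (i, j))" for i
    by (rule sum_mono) (rule mset_subset_eq_count[OF assms(2)])
  show ?thesis
    unfolding affine_monomials_def
  proof (intro CollectI conjI allI impI)
    show "set_mset M' \<subseteq> (SIGMA i:{..<length n}. {1..n ! i})"
      using assms(1) set_mset_mono[OF assms(2)] unfolding affine_monomials_def by blast
    show "(\<Sum>j\<in>{1..n ! i}. count M' (i, j)) \<le> d ! i" if "i < length n" for i
      by (rule order.trans[OF le]) (use assms(1) that in \<open>simp add: affine_monomials_def\<close>)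
  qed
qed

lemma size_affine_monomial:
  assumes "M \<in> affine_monomials n d"
  shows "size M = (\<Sum>i<length n. \<Sum>j\<in>{1..n ! i}. count M (i, j))"
  using assms by (intro size_eq_sum_count) (auto simp: affine_monomials_def)

lemma size_affine_monomial_le:
  assumes "length d = length n" "M \<in> affine_monomials n d"
  shows "size M \<le> sum_list d"
proof -
  have "size M \<le> (\<Sum>i<length n. d ! i)"
    unfolding size_affine_monomial[OF assms(2)]
    by (rule sum_mono) (use assms(2) in \<open>auto simp: affine_monomials_def\<close>)
  then show ?thesis using assms(1) by (simp add: sum_list_sum_nth lessThan_atLeast0)
qed

text \<open>All of them divide the monomial in which every variable has exponent
  \<open>sum_list d\<close>.\<close>

lemma finite_affine_monomials:
  assumes "length d = length n"
  shows "finite (affine_monomials n d)"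
proof -
  let ?X = "SIGMA i:{..<length n}. {1..n ! i}"
  let ?N = "\<Sum>x\<in>?X. replicate_mset (sum_list d) x"
  have "M \<subseteq># ?N" if M: "M \<in> affine_monomials n d" for M
  proof (rule mset_subset_eqI)
    fix x
    show "count M x \<le> count ?N x"
    proof (cases "x \<in> ?X")
      case True
      have "count M x \<le> sum_list d"
        using size_affine_monomial_le[OF assms M] count_le_size[of M x] by linarith
      also have "\<dots> = count ?N x" using True by (simp add: count_sum)
      finally show ?thesis .
    next
      case False
      then have "x \<notin># M" using M by (auto simp: affine_monomials_def)
      then show ?thesis by (simp add: not_in_iff)
    qed
  qed
  then have "affine_monomials n d \<subseteq> {M. M \<subseteq># ?N}" by auto
  then show ?thesis by (rule finite_subset) (rule finite_subset_mset)
qed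

lemma card_monoms:
  "card (monoms n d t) = card {M \<in> affine_monomials n d. int (size M) \<le> t}"
proof -
  let ?X = "SIGMA i:{..<length n}. {1..n ! i}"
  have "bij_betw exponents {M \<in> affine_monomials n d. int (size M) \<le> t} (monoms n d t)"
  proof (rule bij_betw_imageI)
    show "inj_on exponents {M \<in> affine_monomials n d. int (size M) \<le> t}"
      by (rule inj_onI) (auto simp: exponents_def fun_eq_iff intro: multiset_eqI)
    show "exponents ` {M \<in> affine_monomials n d. int (size M) \<le> t} = monoms n d t"
    proof (intro equalityI subsetI)
      fix e assume "e \<in> exponents ` {M \<in> affine_monomials n d. int (size M) \<le> t}"
      then obtain M where M: "M \<in> affine_monomials n d" "int (size M) \<le> t" and e: "e = exponents M" by auto
      have "count M (i, j) = 0" if "i \<ge> length n \<or> j < 1 \<or> j > n ! i" for i j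
        using M(1) that by (auto simp: affine_monomials_def not_in_iff[symmetric])
      then show "e \<in> monoms n d t"
        using M(1) M(2)[unfolded size_affine_monomial[OF M(1)]] unfolding monoms_def e exponents_def affine_monomials_def
        by blast
    next
      fix e assume e: "e \<in> monoms n d t"
      obtain M where M: "set_mset M \<subseteq> ?X" "\<And>i j. count M (i, j) = e i j"
        by (rule multiset_of_exponents[of ?X e]) (use e in \<open>auto simp: monoms_def not_le\<close>)
      have M': "M \<in> affine_monomials n d" using M e by (auto simp: affine_monomials_def monoms_def)
      moreover have "int (size M) \<le> t"
        unfolding size_affine_monomial[OF M'] using e by (simp add: M(2) monoms_def)
      moreover have "e = exponents M" using M by (simp add: exponents_def fun_eq_iff)
      ultimately show "e \<in> exponents ` {M \<in> affine_monomials n d. int (size M) \<le> t}" by blast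
    qed
  qed
  then show ?thesis by (simp add: bij_betw_same_card)
qed

lemma atMost_eq_insert_0: "{..m} = insert 0 {1..m::nat}"
  by auto

text \<open>The inverse forgets the exponents at \<open>j = 0\<close>; these are determined by the
  others because block \<open>i\<close> has degree \<open>d ! i\<close>.\<close>

lemma bij_betw_homogenize:
  assumes "length d = length n"
  shows "bij_betw (homogenize n d) (affine_monomials n d) (Vbasis n d)"
proof (rule bij_betw_imageI)
  let ?X = "SIGMA i:{..<length n}. {1..n ! i}"
  show "inj_on (homogenize n d) (affine_monomials n d)"
  proof (rule inj_onI, rule multiset_eqI)
    fix M M' and x :: "nat \<times> nat" assume M: "M \<in> affine_monomials n d" "M' \<in> affine_monomials n d" "homogenize n d M = homogenize n d M'"
    obtain i j where x: "x = (i, j)" by (cases x)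
    show "count M x = count M' x"
    proof (cases "i < length n \<and> j = 0")
      case True
      then have "x \<notin># M" "x \<notin># M'" using M x by (auto simp: affine_monomials_def)
      then show ?thesis by (simp add: not_in_iff)
    next
      case False
      then show ?thesis using M(3)[THEN fun_cong, THEN fun_cong, of i j] by (auto simp: homogenize_def x)
    qed
  qed
  show "homogenize n d ` affine_monomials n d = Vbasis n d"
  proof (intro equalityI subsetI)
    fix e assume "e \<in> homogenize n d ` affine_monomials n d"
    then obtain M where M: "M \<in> affine_monomials n d" and e: "e = homogenize n d M" by auto
    have "e i j = 0" if "i \<ge> length n \<or> j > n ! i" for i j
    proof -
      have "(i, j) \<notin># M" using M that by (auto simp: affine_monomials_def)
      then show ?thesis using that by (auto simp: e homogenize_def not_in_iff)
    qed
    moreover have "(\<Sum>j\<le>n ! i. e i j) = d ! i" if "i < length n" for i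
      using M that unfolding atMost_eq_insert_0 by (simp add: e homogenize_def affine_monomials_def)
    ultimately show "e \<in> Vbasis n d" by (auto simp: Vbasis_def)
  next
    fix e assume e: "e \<in> Vbasis n d"
    obtain M where M: "set_mset M \<subseteq> ?X" "\<And>i j. count M (i, j) = (if j = 0 then 0 else e i j)"
      by (rule multiset_of_exponents[of ?X "\<lambda>i j. if j = 0 then 0 else e i j"]) (use e in \<open>auto simp: Vbasis_def not_le\<close>)
    have sum: "(\<Sum>j\<in>{1..n ! i}. count M (i, j)) + e i 0 = d ! i" if "i < length n" for i
    proof -
      have "(\<Sum>j\<le>n ! i. e i j) = d ! i" using e that by (simp add: Vbasis_def)
      then show ?thesis unfolding atMost_eq_insert_0 by (simp add: M(2))
    qed
    have "M \<in> affine_monomials n d"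
      unfolding affine_monomials_def
    proof (intro CollectI conjI allI impI)
      show "(\<Sum>j\<in>{1..n ! i}. count M (i, j)) \<le> d ! i" if "i < length n" for i
        using sum[OF that] by linarith
    qed (rule M(1))
    moreover have "homogenize n d M = e"
    proof (intro ext)
      fix i j show "homogenize n d M i j = e i j"
      proof (cases "i < length n \<and> j = 0")
        case True
        then show ?thesis using sum[of i] by (simp add: homogenize_def)
      next
        case False
        then have "homogenize n d M i j = count M (i, j)" by (auto simp: homogenize_def)
        then show ?thesis using False e by (auto simp: M(2) Vbasis_def)
      qed
    qed
    ultimately show "e \<in> homogenize n d ` affine_monomials n d" by blast
  qed
qed

section \<open>Multinomial coefficients and coordinates of simple tensors\<close>

lemma prod_fact_le_fact_sum: "finite A \<Longrightarrow> (\<Prod>x\<in>A. fact (f x)) \<le> (fact (\<Sum>x\<in>A. f x) :: nat)"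
proof (induction A rule: finite_induct)
  case (insert x A)
  have "fact (f x) * (\<Prod>x\<in>A. fact (f x)) \<le> fact (f x) * (fact (\<Sum>x\<in>A. f x) :: nat)"
    by (rule mult_left_mono[OF insert.IH]) simp
  also have "\<dots> \<le> fact (f x + (\<Sum>x\<in>A. f x))"
    by (rule dvd_imp_le[OF fact_fact_dvd_fact]) simp
  finally show ?case using insert by simp
qed auto

definition multinomial :: "nat list \<Rightarrow> nat list \<Rightarrow> (nat \<Rightarrow> nat \<Rightarrow> nat) \<Rightarrow> nat" where
  "multinomial n d e = (\<Prod>i<length n. fact (d ! i) div (\<Prod>j\<le>n ! i. fact (e i j)))"

text \<open>The quotients are integer divisions, and they are positive because each denominator is
  at most its numerator. In characteristic zero the coefficient can therefore be divided by.\<close>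

lemma multinomial_pos:
  assumes "e \<in> Vbasis n d"
  shows "multinomial n d e > 0"
proof -
  have "(\<Prod>j\<le>n ! i. fact (e i j)) \<le> (fact (d ! i) :: nat)" if "i < length n" for i
    using prod_fact_le_fact_sum[of "{..n ! i}" "e i"] assms that by (simp add: Vbasis_def)
  then have "fact (d ! i) div (\<Prod>j\<le>n ! i. fact (e i j)) > (0::nat)" if "i < length n" for i
    using that by (simp add: div_greater_zero_iff prod_pos)
  then show ?thesis by (auto simp: multinomial_def intro!: prod_pos)
qed

text \<open>For linear forms whose coefficient at index 0 is 1, every coordinate of the simple
  tensor is a positive integer times a single monomial in \<open>z\<close>, and distinct coordinates
  carry distinct monomials.\<close>

lemma simple_tensor_homogenize:
  assumes "length d = length n" and M: "M \<in> affine_monomials n d"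
  shows "simple_tensor n d (\<lambda>i j. if j = 0 then 1 else z (i, j)) (homogenize n d M) =
    of_nat (multinomial n d (homogenize n d M)) * \<Prod>\<^sub># (image_mset z M)"
proof -
  let ?X = "SIGMA i:{..<length n}. {1..n ! i}" and ?e = "homogenize n d M"
  have mem: "?e \<in> Vbasis n d" using bij_betwE[OF bij_betw_homogenize[OF assms(1)]] M by blast
  have "\<Prod>\<^sub># (image_mset z M) = (\<Prod>x\<in>?X. z x ^ count M x)"
    unfolding image_prod_mset_multiplicity
    by (rule prod.mono_neutral_left) (use M in \<open>auto simp: affine_monomials_def not_in_iff\<close>)
  also have "\<dots> = (\<Prod>i<length n. \<Prod>j\<in>{1..n ! i}. z (i, j) ^ count M (i, j))"
    by (simp add: prod.Sigma split_def)
  also have "\<dots> = (\<Prod>i<length n. \<Prod>j\<le>n ! i. (if j = 0 then 1 else z (i, j)) ^ ?e i j)"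
    unfolding atMost_eq_insert_0 by (simp add: homogenize_def)
  finally show ?thesis using mem by (simp add: simple_tensor_def multinomial_def prod.distrib)
qed

theorem theorem8p4:
  fixes n d :: "nat list" and p q :: nat
    and \<phi> :: "((nat \<Rightarrow> nat \<Rightarrow> nat) \<Rightarrow> 'a::{alg_closed_field, field_char_0}) \<Rightarrow> 'a mat"
  assumes "length d = length n"
    and "\<forall>i < length n. n ! i > 0" and "\<forall>i < length d. d ! i > 0"
    and "lin_to_mat n d p q \<phi>"
    and "\<exists>v \<in> Vspace n d. \<phi> v \<noteq> 0\<^sub>m p q"
  shows "Pot n d p \<phi> \<le> real (Ycount n d + Zcount n d)"
proof -
  define E where "E = affine_monomials n d"
  define t where "t = sum_list d div 2"
  define coeff where "coeff = (\<lambda>M. of_nat (multinomial n d (homogenize n d M)) :: 'a)"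
  define \<delta> where "\<delta> = (\<lambda>M e. if e = homogenize n d M then 1 else 0 :: 'a)"
  \<comment> \<open>The value of \<open>A\<close> at \<open>z\<close> is the image under
    \<open>\<phi>\<close> of the simple tensor of the forms with coefficient 1 at index 0 and
    \<open>z (i, j)\<close> at \<open>j > 0\<close>. The coefficient at \<open>M\<close> is a
    multiple of the image of one basis vector.\<close>
  define A where "A = mat p q (\<lambda>(i, j). \<Sum>M\<in>E. Poly_Mapping.single M (coeff M * \<phi> (\<delta> M) $$ (i, j)))"
  define r where "r = mu p \<phi> (Sset n d)"
  have finE: "finite E" unfolding E_def by (rule finite_affine_monomials[OF assms(1)])
  have bij: "bij_betw (homogenize n d) E (Vbasis n d)"
    unfolding E_def by (rule bij_betw_homogenize[OF assms(1)])
  have finV: "finite (Vbasis n d)" using bij finE by (simp add: bij_betw_finite)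
  have dims: "\<phi> u \<in> carrier_mat p q" if "u \<in> Vspace n d" for u
    using assms(4) that by (auto simp: lin_to_mat_def)
  have S_V: "Sset n d \<subseteq> Vspace n d" by (auto simp: Sset_def Vspace_def simple_tensor_def)
  have entry: "\<phi> v $$ (i, j) = (\<Sum>M\<in>E. v (homogenize n d M) * \<phi> (\<delta> M) $$ (i, j))"
    if "v \<in> Vspace n d" "i < p" "j < q" for v i j
    unfolding lin_to_mat_entry[OF assms(4) finV that] \<delta>_def by (rule sum.reindex_bij_betw[OF bij, symmetric])
  have finite_ranks: "finite ((\<lambda>x. vec_space.rank p (\<phi> x)) ` X)" if "X \<subseteq> Vspace n d" for X
    by (rule finite_subset[of _ "{..q}"]) (use that vec_space.rank_le_nc[OF dims] in auto)
  have rank_A: "vec_space.rank p (map_mat (eval_mpoly z) A) \<le> r" for z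
  proof -
    let ?v = "simple_tensor n d (\<lambda>i j. if j = 0 then 1 else z (i, j))"
    interpret comm_ring_hom "eval_mpoly z :: (nat \<times> nat, 'a) mpoly \<Rightarrow> 'a" by (rule comm_ring_hom_eval_mpoly)
    have v: "?v \<in> Sset n d" by (auto simp: Sset_def)
    then have vV: "?v \<in> Vspace n d" using S_V by auto
    have "map_mat (eval_mpoly z) A = \<phi> ?v"
    proof (rule eq_matI)
      fix i j assume "i < dim_row (\<phi> ?v)" "j < dim_col (\<phi> ?v)"
      then have ij: "i < p" "j < q" using dims[OF vV] by auto
      show "map_mat (eval_mpoly z) A $$ (i, j) = \<phi> ?v $$ (i, j)"
        using ij by (auto simp: A_def hom_sum insertion_single entry[OF vV ij] E_def coeff_def
            simple_tensor_homogenize[OF assms(1)] mult_ac intro!: sum.cong)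
    qed (use dims[OF vV] in \<open>auto simp: A_def\<close>)
    then show ?thesis
      unfolding r_def mu_def by (intro Max_ge finite_ranks[OF S_V] image_eqI[OF _ v]) simp
  qed
  have lookup_A: "Poly_Mapping.lookup (A $$ (i, j)) M = (if M \<in> E then coeff M * \<phi> (\<delta> M) $$ (i, j) else 0)"
    if "i < p" "j < q" for i j M
    using that finE by (simp add: A_def lookup_sum lookup_single when_def)
  have card_Y: "Ycount n d = card {M \<in> E. size M \<le> t}"
    by (simp add: Ycount_def card_monoms E_def t_def)
  \<comment> \<open>For integers, \<open>m \<le> d - (d div 2 + 1)\<close> is the strict inequality
    \<open>m < d - d div 2\<close>, with \<open>d\<close> the total degree; this matches the bound
    \<open>size e < t2\<close>.\<close>
  have card_Z: "Zcount n d = card {M \<in> E. size M < sum_list d - t}"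
  proof -
    have "int m \<le> int (sum_list d) - (int (sum_list d div 2) + 1) \<longleftrightarrow> m < sum_list d - t" for m
      unfolding t_def by linarith
    then show ?thesis by (simp add: Zcount_def card_monoms E_def)
  qed
  have rank_le: "vec_space.rank p (\<phi> v) \<le> r * (Ycount n d + Zcount n d)" if v: "v \<in> Vspace n d" for v
  proof -
    \<comment> \<open>Dividing by the multinomial coefficient recovers an arbitrary \<open>v\<close>
      from the coefficients of \<open>A\<close>; this is where characteristic zero makes every
      \<open>\<phi> v\<close> a combination of them.\<close>
    define l where "l = (\<lambda>M. v (homogenize n d M) / coeff M)"
    have coeff: "coeff M \<noteq> 0" if "M \<in> E" for M
      using multinomial_pos bij_betwE[OF bij] that by (fastforce simp: coeff_def)
    have "\<phi> v = mat p q (\<lambda>(i, j). \<Sum>M\<in>E. l M * Poly_Mapping.lookup (A $$ (i, j)) M)"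
      by (rule eq_matI) (use dims[OF v] coeff in \<open>auto simp: lookup_A entry[OF v] l_def intro!: sum.cong\<close>)
    moreover have "vec_space.rank p \<dots> \<le> r * (card {M \<in> E. size M \<le> t} + card {M \<in> E. size M < sum_list d - t})"
    proof (rule rank_coefficient_combination[OF _ rank_A])
      show "A \<in> carrier_mat p q" by (simp add: A_def)
      show "Poly_Mapping.keys (A $$ (i, j)) \<subseteq> E" if "i < p" "j < q" for i j
        using lookup_A[OF that] by (auto simp: in_keys_iff split: if_splits)
      show "M' \<in> E" if "M \<in> E" "M' \<subseteq># M" for M M'
        using affine_monomials_subset that by (auto simp: E_def)
      show "size M \<le> t + (sum_list d - t)" if "M \<in> E" for M
        using size_affine_monomial_le[OF assms(1)] that by (force simp: E_def t_def)
    qed (rule finE)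
    ultimately show ?thesis by (simp add: card_Y card_Z)
  qed
  \<comment> \<open>The zero vector shows that the maximum defining \<open>mu\<close> is over a
    nonempty set.\<close>
  have "(\<lambda>_. 0) \<in> Vspace n d" by (simp add: Vspace_def)
  then have "mu p \<phi> (Vspace n d) \<le> r * (Ycount n d + Zcount n d)"
    unfolding mu_def by (intro Max.boundedI finite_ranks) (use rank_le in auto)
  then have "real (mu p \<phi> (Vspace n d)) \<le> real (Ycount n d + Zcount n d) * real r"
    by (metis mult.commute of_nat_le_iff of_nat_mult)
  then show ?thesis
    \<comment> \<open>If \<open>r = 0\<close>, the quotient is 0 by the convention for division by
      zero, and the bound is nonnegative.\<close>
    unfolding Pot_def r_def[symmetric] by (cases "r = 0") (simp_all add: divide_le_eq)
qed

end
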